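(* Let $\mathcal{L}$ be a countable language in the logic for metric structures, and suppose that $M$ and $N$ are two proper $\mathcal{L}$-structures. The following statements are equivalent: (1) $\varphi^M=\varphi^N$ for every restricted universal sentence $\varphi$; (2) $\varphi^M=\varphi^N$ for every universal sentence $\varphi$; (3) $\varphi^M=\varphi^N$ for every existential sentence $\varphi$; (4) $d_{GH}(M,N)=0$; (5) $M$ and $N$ are isomorphic; (6) $M$ and $N$ are bi-embeddable.
   Context: Metric structures. The logic is the one for possibly unbounded metric structures, in which the language $\mathcal{L}$ comes with domains of quantification, enumerated as $(D_k)_{k\in\mathbb{N}}$, and the allowed quantifiers are $\sup_{x\in D}$ and $\inf_{x\in D}$ for a domain of quantification $D$. Without loss of generality $\mathcal{L}$ contains only relation symbols, including a binary symbol $d$ for the metric (otherwise each function symbol is replaced with a relation symbol to be interpreted as the graph of the function), and has just one sort (the multi-sorted case is obtained by a suitable adaptation). An $\mathcal{L}$-structure $M$ is a separable, complete, nonempty metric space $(M,d)$ with closed subsets $D_1(M)\subset D_2(M)\subset\cdots$ with dense union, interpreting the domains of quantification, and, for each $n$-ary relation symbol $B$, a real-valued function $B^M$ on $M^n$ obeying the uniform continuity moduli and the bounds prescribed by $\mathcal{L}$. $M$ is proper if the interpretation $D(M)$ of every domain of quantification $D$ is compact. An embedding $M\to N$ is an isometric map sending each $D_k(M)$ into $D_k(N)$ and preserving the values of all relations; an isomorphism is a bijective embedding whose inverse is an embedding; bi-embeddable means that each embeds in the other. Formulas. Formulas are built from atomic formulas $B(x_1,\ldots,x_n)$ using continuous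 real functions as connectives and the quantifiers above; a sentence is a formula without free variables, and $\varphi^M$ is the value of $\varphi$ in $M$. A formula is universal if it only uses the quantifier $\sup$, and existential if it only uses the quantifier $\inf$. For every $n\in\mathbb{N}$ fix a countable, uniformly dense set $\mathcal{F}_n$ of continuous functions from the interval $[-n,n]$ to itself. A formula is restricted if it only uses connectives from $\bigcup_n\mathcal{F}_n$. Gromov–Hausdorff distance. A function $f:X\to[0,+\infty]$ on a metric space is Katětov if $|f(x)-f(y)|\le d(x,y)\le f(x)+f(y)$ for all $x,y\in X$. An approximate isometry $\psi:X\leadsto Y$ between metric spaces is a function $\psi:X\times Y\to[0,+\infty]$ that is separately Katětov in each argument. It is an $\varepsilon$-bijection if for every $r>\varepsilon$: for every $x\in X$ there is $y\in Y$ with $\psi(x,y)<r$, and for every $y\in Y$ there is $x\in X$ with $\psi(x,y)<r$. If $\psi:M\leadsto N$ and $B$ is an $n$-ary relation symbol, identify $B^M$ and $B^N$ with their graphs, endowed with the max-metric, and define $\psi^B:B^M\leadsto B^N$ by $$\psi^B\big(\bar x,B(\bar x),\bar y,B(\bar y)\big)=\max\{\psi(x_1,y_1),\ldots,\psi(x_n,y_n),|B(\bar x)-B(\bar y)|\}.$$ For a set $\mathcal{L}_0$ of relation symbols, an $(\mathcal{L}_0,\varepsilon)$-approximate isomorphism from $M$ to $N$ is an approximate isometry $\psi:M\leadsto N$ such that $\psi^B$ is an $\varepsilon$-bijection for every $B\in\mathcal{L}_0$. For a domain of quantification $D$, a $(D,\mathcal{L}_0,\varepsilon)$-approximate isomorphism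 from $M$ to $N$ is an approximate isometry $\psi:M\leadsto N$ whose restriction to $D(M)\times D(N)$ is an $(\mathcal{L}_0,\varepsilon)$-approximate isomorphism from $D(M)$ to $D(N)$. Write $\mathcal{L}$ as an increasing union of finite languages $\mathcal{L}_k$, $k\in\mathbb{N}$, with $d\in\mathcal{L}_1$. Let $d_k(M,N)$ be the infimum of the $\varepsilon>0$ such that there is a $(D_k,\mathcal{L}_k,\varepsilon)$-approximate isomorphism from $M$ to $N$, and set $d_{GH}(M,N)=\sum_{k\in\mathbb{N}}2^{-k}d_k(M,N)$.
   Formalization: Two definitions are corrected, since the claim fails otherwise: F_n contains dense sets of continuous connectives from [-n,n]^m to [-n,n] for every arity m, and d_k(M,N) asks for a single ψ that is a (D_j,L_j,ε)-approximate isomorphism for all j≤k at once. *)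

theory Defs
  imports "HOL-Analysis.Analysis"
begin

text \<open>
  Conventions. An \<open>n\<close>-tuple over a type is an element of the extensional function space
  \<open>{..<n} \<rightarrow>\<^sub>E UNIV\<close>, with the product topology.
  Domains and finite sublanguages are indexed from \<open>0\<close>, so index \<open>k\<close> here is the index
  \<open>k + 1\<close> of an enumeration starting at \<open>1\<close>.
\<close>

definition tuple :: "'a list \<Rightarrow> nat \<Rightarrow> 'a" where
  "tuple vs = (\<lambda>i\<in>{..<length vs}. vs ! i)"


section \<open>Languages and structures\<close>

text \<open>
  \<open>modulus L B k\<close> and \<open>bound L B k\<close> are the modulus of uniform continuity and the bound
  that \<open>L\<close> prescribes for the relation symbol \<open>B\<close> on the \<open>k\<close>-th domain.
\<close>

record 'r language =
  symbols :: "'r set"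
  arity :: "'r \<Rightarrow> nat"
  metric_symbol :: 'r
  modulus :: "'r \<Rightarrow> nat \<Rightarrow> real \<Rightarrow> real"
  bound :: "'r \<Rightarrow> nat \<Rightarrow> real"

definition is_language :: "'r language \<Rightarrow> bool" where
  "is_language L \<longleftrightarrow>
     metric_symbol L \<in> symbols L \<and> arity L (metric_symbol L) = 2 \<and>
     (\<forall>B\<in>symbols L. \<forall>k. 0 \<le> bound L B k \<and> (\<forall>\<epsilon>>0. 0 < modulus L B k \<epsilon>))"

text \<open>
  The underlying space of a structure is a type of class \<open>polish_space\<close>, that is, a nonempty
  separable complete metric space with metric \<open>dist\<close>.
\<close>

record ('r, 'm) metric_structure =
  domain :: "nat \<Rightarrow> 'm set"
  interp :: "'r \<Rightarrow> (nat \<Rightarrow> 'm) \<Rightarrow> real"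

text \<open>
  Moduli may depend on the domain. Since the union of the domains is only dense, continuity on
  the whole space is required as well; when the moduli do not depend on the domain, the two
  requirements together say that \<open>B\<close> obeys its modulus on the whole space.
\<close>

definition is_structure :: "'r language \<Rightarrow> ('r, 'm::polish_space) metric_structure \<Rightarrow> bool" where
  "is_structure L M \<longleftrightarrow>
     (\<forall>k. closed (domain M k)) \<and> incseq (domain M) \<and> closure (\<Union>k. domain M k) = UNIV \<and>
     (\<forall>B\<in>symbols L.
        continuous_map (product_topology (\<lambda>_. euclidean) {..<arity L B}) euclideanreal (interp M B) \<and>
        (\<forall>k. \<forall>x \<in> {..<arity L B} \<rightarrow>\<^sub>E domain M k.
           \<bar>interp M B x\<bar> \<le> bound L B k \<and>
           (\<forall>y \<in> {..<arity L B} \<rightarrow>\<^sub>E domain M k. \<forall>\<epsilon>>0.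
              (\<forall>i<arity L B. dist (x i) (y i) < modulus L B k \<epsilon>) \<longrightarrow>
              \<bar>interp M B x - interp M B y\<bar> \<le> \<epsilon>))) \<and>
     (\<forall>x \<in> {..<2} \<rightarrow>\<^sub>E UNIV. interp M (metric_symbol L) x = dist (x 0) (x 1))"

definition proper :: "('r, 'm::polish_space) metric_structure \<Rightarrow> bool" where
  "proper M \<longleftrightarrow> (\<forall>k. compact (domain M k))"

definition embedding ::
  "'r language \<Rightarrow> ('r, 'm::polish_space) metric_structure \<Rightarrow> ('r, 'n::polish_space) metric_structure
     \<Rightarrow> ('m \<Rightarrow> 'n) \<Rightarrow> bool" where
  "embedding L M N f \<longleftrightarrow>
     (\<forall>x y. dist (f x) (f y) = dist x y) \<and>
     (\<forall>k. f ` domain M k \<subseteq> domain N k) \<and>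
     (\<forall>B\<in>symbols L. \<forall>x \<in> {..<arity L B} \<rightarrow>\<^sub>E UNIV.
        interp N B (compose {..<arity L B} f x) = interp M B x)"

definition embeds ::
  "'r language \<Rightarrow> ('r, 'm::polish_space) metric_structure \<Rightarrow> ('r, 'n::polish_space) metric_structure
     \<Rightarrow> bool" where
  "embeds L M N \<longleftrightarrow> (\<exists>f. embedding L M N f)"

definition isomorphic ::
  "'r language \<Rightarrow> ('r, 'm::polish_space) metric_structure \<Rightarrow> ('r, 'n::polish_space) metric_structure
     \<Rightarrow> bool" where
  "isomorphic L M N \<longleftrightarrow> (\<exists>f. bij f \<and> embedding L M N f \<and> embedding L N M (inv f))"


section \<open>Formulas\<close>

text \<open>
  Variables are natural numbers. \<open>QSup k x \<phi>\<close> and \<open>QInf k x \<phi>\<close> quantify the variable \<open>x\<close> over the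
  \<open>k\<close>-th domain. \<open>Conn u \<phi>s\<close> applies the connective \<open>u\<close>, whose arity is the length of \<open>\<phi>s\<close>.
\<close>

datatype 'r formula =
    Atom 'r "nat list"
  | Conn "(nat \<Rightarrow> real) \<Rightarrow> real" "'r formula list"
  | QSup nat nat "'r formula"
  | QInf nat nat "'r formula"

fun wf_formula :: "'r language \<Rightarrow> 'r formula \<Rightarrow> bool" where
  "wf_formula L (Atom B xs) \<longleftrightarrow> B \<in> symbols L \<and> length xs = arity L B"
| "wf_formula L (Conn u \<phi>s) \<longleftrightarrow>
     continuous_map (product_topology (\<lambda>_. euclideanreal) {..<length \<phi>s}) euclideanreal u \<and>
     (\<forall>\<phi>\<in>set \<phi>s. wf_formula L \<phi>)"
| "wf_formula L (QSup k x \<phi>) \<longleftrightarrow> wf_formula L \<phi>"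
| "wf_formula L (QInf k x \<phi>) \<longleftrightarrow> wf_formula L \<phi>"

fun free_vars :: "'r formula \<Rightarrow> nat set" where
  "free_vars (Atom B xs) = set xs"
| "free_vars (Conn u \<phi>s) = (\<Union>\<phi>\<in>set \<phi>s. free_vars \<phi>)"
| "free_vars (QSup k x \<phi>) = free_vars \<phi> - {x}"
| "free_vars (QInf k x \<phi>) = free_vars \<phi> - {x}"

definition sentence :: "'r language \<Rightarrow> 'r formula \<Rightarrow> bool" where
  "sentence L \<phi> \<longleftrightarrow> wf_formula L \<phi> \<and> free_vars \<phi> = {}"

fun universal :: "'r formula \<Rightarrow> bool" where
  "universal (Atom B xs) \<longleftrightarrow> True"
| "universal (Conn u \<phi>s) \<longleftrightarrow> (\<forall>\<phi>\<in>set \<phi>s. universal \<phi>)"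
| "universal (QSup k x \<phi>) \<longleftrightarrow> universal \<phi>"
| "universal (QInf k x \<phi>) \<longleftrightarrow> False"

fun existential :: "'r formula \<Rightarrow> bool" where
  "existential (Atom B xs) \<longleftrightarrow> True"
| "existential (Conn u \<phi>s) \<longleftrightarrow> (\<forall>\<phi>\<in>set \<phi>s. existential \<phi>)"
| "existential (QSup k x \<phi>) \<longleftrightarrow> False"
| "existential (QInf k x \<phi>) \<longleftrightarrow> existential \<phi>"

text \<open>
  A domain is allowed to be empty; both quantifiers over an empty domain then return \<open>0\<close>.
\<close>

fun eval :: "('r, 'm) metric_structure \<Rightarrow> (nat \<Rightarrow> 'm) \<Rightarrow> 'r formula \<Rightarrow> real" where
  "eval M \<sigma> (Atom B xs) = interp M B (tuple (map \<sigma> xs))"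
| "eval M \<sigma> (Conn u \<phi>s) = u (tuple (map (eval M \<sigma>) \<phi>s))"
| "eval M \<sigma> (QSup k x \<phi>) =
     (if domain M k = {} then 0 else (SUP a\<in>domain M k. eval M (\<sigma>(x := a)) \<phi>))"
| "eval M \<sigma> (QInf k x \<phi>) =
     (if domain M k = {} then 0 else (INF a\<in>domain M k. eval M (\<sigma>(x := a)) \<phi>))"

lemma eval_cong_free_vars:
  "(\<And>x. x \<in> free_vars \<phi> \<Longrightarrow> \<sigma> x = \<tau> x) \<Longrightarrow> eval M \<sigma> \<phi> = eval M \<tau> \<phi>"
proof (induction \<phi> arbitrary: \<sigma> \<tau>)
  case (Atom B xs)
  have "map \<sigma> xs = map \<tau> xs"
    by (rule map_cong[OF refl]) (rule Atom.prems, simp)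
  then have "interp M B (tuple (map \<sigma> xs)) = interp M B (tuple (map \<tau> xs))"
    by (rule arg_cong)
  then show ?case
    unfolding eval.simps .
next
  case (Conn u \<phi>s)
  have "map (eval M \<sigma>) \<phi>s = map (eval M \<tau>) \<phi>s"
    by (rule map_cong[OF refl], rule Conn.IH, assumption, rule Conn.prems) auto
  then have "u (tuple (map (eval M \<sigma>) \<phi>s)) = u (tuple (map (eval M \<tau>) \<phi>s))"
    by (rule arg_cong)
  then show ?case
    unfolding eval.simps .
next
  case (QSup k x \<phi>)
  have "eval M (\<sigma>(x := a)) \<phi> = eval M (\<tau>(x := a)) \<phi>" for a
    using QSup.prems by (intro QSup.IH) auto
  then show ?case by simp
next
  case (QInf k x \<phi>)
  have "eval M (\<sigma>(x := a)) \<phi> = eval M (\<tau>(x := a)) \<phi>" for a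
    using QInf.prems by (intro QInf.IH) auto
  then show ?case by simp
qed

text \<open>
  By the previous lemma, the assignment is irrelevant for a sentence.
\<close>

definition sentence_value :: "('r, 'm) metric_structure \<Rightarrow> 'r formula \<Rightarrow> real" where
  "sentence_value M \<phi> = eval M (\<lambda>_. undefined) \<phi>"


subsection \<open>Restricted formulas\<close>

abbreviation cube_topology :: "nat \<Rightarrow> nat \<Rightarrow> (nat \<Rightarrow> real) topology" where
  "cube_topology n m \<equiv> product_topology (\<lambda>_. top_of_set {- real n..real n}) {..<m}"

text \<open>
  \<open>F n m\<close> is the chosen dense set of \<open>m\<close>-ary connectives on the interval \<open>[-n, n]\<close>. All arities
  are needed: with unary connectives alone, the equilateral spaces with three and with four
  points would satisfy the same restricted sentences.
\<close>

definition dense_connectives :: "(nat \<Rightarrow> nat \<Rightarrow> ((nat \<Rightarrow> real) \<Rightarrow> real) set) \<Rightarrow> bool" where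
  "dense_connectives F \<longleftrightarrow>
     (\<forall>n\<ge>1. \<forall>m.
        countable (F n m) \<and>
        (\<forall>g\<in>F n m. continuous_map (cube_topology n m) (top_of_set {- real n..real n}) g) \<and>
        (\<forall>h. continuous_map (cube_topology n m) (top_of_set {- real n..real n}) h \<longrightarrow>
           (\<forall>\<epsilon>>0. \<exists>g\<in>F n m. \<forall>v\<in>topspace (cube_topology n m). \<bar>g v - h v\<bar> < \<epsilon>)))"

text \<open>
  The bound that \<open>L\<close> prescribes for the values of a formula, when each variable \<open>x\<close> ranges over
  the domain with index \<open>c x\<close>.
\<close>

fun formula_bound :: "'r language \<Rightarrow> (nat \<Rightarrow> nat) \<Rightarrow> 'r formula \<Rightarrow> real" where
  "formula_bound L c (Atom B xs) = bound L B (Max (insert 0 (c ` set xs)))"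
| "formula_bound L c (Conn u \<phi>s) =
     (SUP v \<in> (\<Pi>\<^sub>E i\<in>{..<length \<phi>s}.
                {- (map (formula_bound L c) \<phi>s ! i)..map (formula_bound L c) \<phi>s ! i}). \<bar>u v\<bar>)"
| "formula_bound L c (QSup k x \<phi>) = formula_bound L (c(x := k)) \<phi>"
| "formula_bound L c (QInf k x \<phi>) = formula_bound L (c(x := k)) \<phi>"

text \<open>
  A connective \<open>g \<in> F n m\<close> can only be applied to formulas with values in \<open>[-n, n]\<close>, as guaranteed
  by the bounds of the language. Connectives being total functions in the datatype, \<open>g\<close> is
  represented by any \<open>u\<close> extending it; the values of \<open>u\<close> outside of the cube play no role.
\<close>

fun restricted_in ::
  "'r language \<Rightarrow> (nat \<Rightarrow> nat \<Rightarrow> ((nat \<Rightarrow> real) \<Rightarrow> real) set) \<Rightarrow> (nat \<Rightarrow> nat) \<Rightarrow> 'r formula \<Rightarrow> bool"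
where
  "restricted_in L F c (Atom B xs) \<longleftrightarrow> True"
| "restricted_in L F c (Conn u \<phi>s) \<longleftrightarrow>
     (\<exists>n\<ge>1. (\<exists>g\<in>F n (length \<phi>s). \<forall>v\<in>topspace (cube_topology n (length \<phi>s)). u v = g v) \<and>
            (\<forall>\<phi>\<in>set \<phi>s. formula_bound L c \<phi> \<le> real n)) \<and>
     (\<forall>\<phi>\<in>set \<phi>s. restricted_in L F c \<phi>)"
| "restricted_in L F c (QSup k x \<phi>) \<longleftrightarrow> restricted_in L F (c(x := k)) \<phi>"
| "restricted_in L F c (QInf k x \<phi>) \<longleftrightarrow> restricted_in L F (c(x := k)) \<phi>"

text \<open>
  In a sentence every variable is bound, so that the initial context is irrelevant.
\<close>

definition restricted_sentence ::
  "'r language \<Rightarrow> (nat \<Rightarrow> nat \<Rightarrow> ((nat \<Rightarrow> real) \<Rightarrow> real) set) \<Rightarrow> 'r formula \<Rightarrow> bool" where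
  "restricted_sentence L F \<phi> \<longleftrightarrow> sentence L \<phi> \<and> restricted_in L F (\<lambda>_. 0) \<phi>"


section \<open>The Gromov--Hausdorff distance\<close>

text \<open>
  The condition \<open>\<bar>f x - f y\<bar> \<le> d(x, y)\<close> is written without subtraction, since \<open>f\<close> may be infinite.
\<close>

definition katetov_on :: "'a::metric_space set \<Rightarrow> ('a \<Rightarrow> ennreal) \<Rightarrow> bool" where
  "katetov_on X f \<longleftrightarrow>
     (\<forall>x\<in>X. \<forall>y\<in>X. f x \<le> f y + ennreal (dist x y) \<and> f y \<le> f x + ennreal (dist x y) \<and>
        ennreal (dist x y) \<le> f x + f y)"

definition approx_isometry ::
  "'a::metric_space set \<Rightarrow> 'b::metric_space set \<Rightarrow> ('a \<Rightarrow> 'b \<Rightarrow> ennreal) \<Rightarrow> bool" where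
  "approx_isometry X Y \<psi> \<longleftrightarrow>
     (\<forall>x\<in>X. katetov_on Y (\<lambda>y. \<psi> x y)) \<and> (\<forall>y\<in>Y. katetov_on X (\<lambda>x. \<psi> x y))"

definition eps_bijection :: "real \<Rightarrow> 'a set \<Rightarrow> 'b set \<Rightarrow> ('a \<Rightarrow> 'b \<Rightarrow> ennreal) \<Rightarrow> bool" where
  "eps_bijection \<epsilon> X Y \<psi> \<longleftrightarrow>
     (\<forall>r>\<epsilon>. (\<forall>x\<in>X. \<exists>y\<in>Y. \<psi> x y < ennreal r) \<and> (\<forall>y\<in>Y. \<exists>x\<in>X. \<psi> x y < ennreal r))"

definition rel_graph :: "nat \<Rightarrow> 'm set \<Rightarrow> ((nat \<Rightarrow> 'm) \<Rightarrow> real) \<Rightarrow> ((nat \<Rightarrow> 'm) \<times> real) set" where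
  "rel_graph n X b = (\<lambda>x. (x, b x)) ` ({..<n} \<rightarrow>\<^sub>E X)"

definition graph_lift ::
  "nat \<Rightarrow> ('m \<Rightarrow> 'n \<Rightarrow> ennreal) \<Rightarrow> (nat \<Rightarrow> 'm) \<times> real \<Rightarrow> (nat \<Rightarrow> 'n) \<times> real \<Rightarrow> ennreal" where
  "graph_lift n \<psi> p q =
     Max (insert (ennreal \<bar>snd p - snd q\<bar>) ((\<lambda>i. \<psi> (fst p i) (fst q i)) ` {..<n}))"

text \<open>
  An \<open>(L\<^sub>0, \<epsilon>)\<close>-approximate isomorphism from the subset \<open>X\<close> of \<open>M\<close> to the subset \<open>Y\<close> of \<open>N\<close>.
\<close>

definition approx_isomorphism ::
  "'r language \<Rightarrow> 'r set \<Rightarrow> real \<Rightarrow>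
     ('r, 'm::polish_space) metric_structure \<Rightarrow> 'm set \<Rightarrow>
     ('r, 'n::polish_space) metric_structure \<Rightarrow> 'n set \<Rightarrow> ('m \<Rightarrow> 'n \<Rightarrow> ennreal) \<Rightarrow> bool" where
  "approx_isomorphism L L\<^sub>0 \<epsilon> M X N Y \<psi> \<longleftrightarrow>
     approx_isometry X Y \<psi> \<and>
     (\<forall>B\<in>L\<^sub>0. eps_bijection \<epsilon>
        (rel_graph (arity L B) X (interp M B)) (rel_graph (arity L B) Y (interp N B))
        (graph_lift (arity L B) \<psi>))"

definition domain_approx_isomorphism ::
  "'r language \<Rightarrow> nat \<Rightarrow> 'r set \<Rightarrow> real \<Rightarrow>
     ('r, 'm::polish_space) metric_structure \<Rightarrow> ('r, 'n::polish_space) metric_structure \<Rightarrow>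
     ('m \<Rightarrow> 'n \<Rightarrow> ennreal) \<Rightarrow> bool" where
  "domain_approx_isomorphism L k L\<^sub>0 \<epsilon> M N \<psi> \<longleftrightarrow>
     approx_isometry UNIV UNIV \<psi> \<and>
     approx_isomorphism L L\<^sub>0 \<epsilon> M (domain M k) N (domain N k) \<psi>"

definition exhaustion :: "'r language \<Rightarrow> (nat \<Rightarrow> 'r set) \<Rightarrow> bool" where
  "exhaustion L Ls \<longleftrightarrow>
     (\<forall>k. finite (Ls k)) \<and> incseq Ls \<and> (\<Union>k. Ls k) = symbols L \<and> metric_symbol L \<in> Ls 0"

text \<open>
  The distance at level \<open>k\<close> asks for one \<open>\<psi>\<close> that works for all levels \<open>j \<le> k\<close>. Looking at
  level \<open>k\<close> alone would ignore how the smaller domains sit inside the \<open>k\<close>-th one: on the subspace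
  \<open>{0, 1, 3}\<close> of the line, with all domains but the first equal to the whole space, the choices
  \<open>{0}\<close> and \<open>{1}\<close> for the first domain would be at distance \<open>0\<close>, but they are not isomorphic.
\<close>

definition level_distance ::
  "'r language \<Rightarrow> (nat \<Rightarrow> 'r set) \<Rightarrow>
     ('r, 'm::polish_space) metric_structure \<Rightarrow> ('r, 'n::polish_space) metric_structure \<Rightarrow>
     nat \<Rightarrow> ennreal" where
  "level_distance L Ls M N k =
     Inf {ennreal \<epsilon> | \<epsilon>. \<epsilon> > 0 \<and>
       (\<exists>\<psi>. \<forall>j\<le>k. domain_approx_isomorphism L j (Ls j) \<epsilon> M N \<psi>)}"

definition gh_distance ::
  "'r language \<Rightarrow> (nat \<Rightarrow> 'r set) \<Rightarrow>
     ('r, 'm::polish_space) metric_structure \<Rightarrow> ('r, 'n::polish_space) metric_structure \<Rightarrow>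
     ennreal" where
  "gh_distance L Ls M N = (\<Sum>k. ennreal ((1 / 2) ^ Suc k) * level_distance L Ls M N k)"

end

theory Submission
  imports Defs
begin

text \<open>
  Conditions (1) to (4) all reduce to one finitary condition, required in both directions: finitely
  many points of \<open>M\<close>, taken in prescribed domains, can be copied into the same domains of \<open>N\<close> so that
  finitely many relations change by less than \<open>\<epsilon>\<close>. By Tychonoff's theorem a proper \<open>N\<close> then contains an
  exact copy of a countable subset of \<open>M\<close> that is dense in every domain, and this copy extends to an
  embedding. Two embeddings in opposite directions are surjective, because an isometric map of a
  compact domain into itself is onto.

  A configuration of \<open>M\<close> is detected by the supremum, over the domains, of a bump function around its
  relation values; connectives from the chosen dense sets approximate the bump. If \<open>d\<^sub>G\<^sub>H(M, N) = 0\<close>,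
  the copy consists of points close to the given ones with respect to an approximate isometry, and
  the moduli of uniform continuity control the relations.
\<close>

section \<open>Tuples and their coordinates\<close>

lemma tuple_apply: "i < length vs \<Longrightarrow> tuple vs i = vs ! i"
  by (simp add: tuple_def)

lemma tuple_in_PiE: "set vs \<subseteq> A \<Longrightarrow> tuple vs \<in> {..<length vs} \<rightarrow>\<^sub>E A"
  by (auto simp: tuple_def subset_iff)

lemma compose_tuple: "compose {..<length vs} f (tuple vs) = tuple (map f vs)"
  by (auto simp: compose_def tuple_def fun_eq_iff restrict_def)

lemma PiE_mono_domain:
  assumes "x \<in> I \<rightarrow>\<^sub>E A" "A \<subseteq> B"
  shows "x \<in> I \<rightarrow>\<^sub>E B"
  using PiE_mono[of I "\<lambda>_. A" "\<lambda>_. B"] assms by blast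

section \<open>Mutual embeddings of proper structures\<close>

lemma isometry_compact_onto:
  fixes f :: "'a::metric_space \<Rightarrow> 'a"
  assumes iso: "\<And>x y. dist (f x) (f y) = dist x y" and K: "compact K" "f ` K \<subseteq> K"
  shows "f ` K = K"
proof (rule ccontr)
  assume "f ` K \<noteq> K"
  then obtain p where p: "p \<in> K" "p \<notin> f ` K"
    using K by blast
  have "continuous_on K f"
    unfolding continuous_on_iff by (metis iso)
  then have "closed (f ` K)"
    using K(1) by (simp add: compact_continuous_image compact_imp_closed)
  then have "open (- f ` K)"
    by blast
  then obtain \<delta> where \<delta>: "\<delta> > 0" "ball p \<delta> \<subseteq> - f ` K"
    using p(2) open_contains_ball[of "- f ` K"] by blast
  define s where "s n = (f ^^ n) p" for n
  have sK: "s n \<in> K" for n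
    using K(2) p(1) by (induction n) (auto simp: s_def)
  have shift: "dist (s m) (s (m + n)) = dist p (s n)" for m n
    by (induction m) (auto simp: s_def iso)
  have sep: "\<delta> \<le> dist (s m) (s n)" if less: "m < n" for m n
  proof -
    obtain d where d: "n = m + Suc d"
      using less_imp_Suc_add[OF less] by auto
    have "s (Suc d) \<in> f ` K"
      using sK[of d] by (simp add: s_def)
    then show ?thesis
      unfolding d shift using \<delta>(2) by (force simp: not_less[symmetric])
  qed
  obtain l r where r: "strict_mono r" "(s \<circ> r) \<longlonglongrightarrow> l"
    using seq_compactE[OF compact_imp_seq_compact[OF K(1)]] sK by blast
  then have "Cauchy (s \<circ> r)"
    by (simp add: LIMSEQ_imp_Cauchy)
  then obtain n where "\<And>i j. i \<ge> n \<Longrightarrow> j \<ge> n \<Longrightarrow> dist (s (r i)) (s (r j)) < \<delta>"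
    using \<delta>(1) unfolding Cauchy_def o_def by blast
  from this[of n "Suc n"] sep[of "r n" "r (Suc n)"] show False
    using r(1) by (simp add: strict_mono_def)
qed

lemma interp_metric_symbol:
  assumes "is_structure L M"
  shows "interp M (metric_symbol L) (tuple [x, y]) = dist x y"
proof -
  have "tuple [x, y] \<in> {..<2} \<rightarrow>\<^sub>E UNIV"
    using tuple_in_PiE[of "[x, y]" UNIV] by (simp add: numeral_2_eq_2)
  then show ?thesis
    using assms by (simp add: is_structure_def tuple_apply)
qed

text \<open>The limit may lie outside every domain, where the moduli say nothing; continuity on the
  whole space is what \<open>is_structure\<close> provides for this case.\<close>

lemma interp_tendsto:
  assumes M: "is_structure L M" and B: "B \<in> symbols L"
    and x: "x \<in> {..<arity L B} \<rightarrow>\<^sub>E UNIV" "\<And>j. s j \<in> {..<arity L B} \<rightarrow>\<^sub>E UNIV"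
    and lim: "\<And>i. i < arity L B \<Longrightarrow> (\<lambda>j. s j i) \<longlonglongrightarrow> x i"
  shows "(\<lambda>j. interp M B (s j)) \<longlonglongrightarrow> interp M B x"
proof -
  have "continuous_map (product_topology (\<lambda>_. euclidean) {..<arity L B}) euclideanreal (interp M B)"
    using M B by (simp add: is_structure_def)
  moreover have "limitin (product_topology (\<lambda>_. euclidean) {..<arity L B}) s x sequentially"
    using x lim by (auto simp: limitin_componentwise PiE_def)
  ultimately have "limitin euclideanreal (interp M B \<circ> s) (interp M B x) sequentially"
    by (rule continuous_map_limit)
  then show ?thesis
    by (simp add: o_def)
qed

lemma interp_tuple_tendsto:
  fixes b :: "nat \<Rightarrow> 'i \<Rightarrow> 'm::polish_space"
  assumes "is_structure L M" "B \<in> symbols L" and t: "length t = arity L B"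
    and lim: "\<And>i. i \<in> set t \<Longrightarrow> (\<lambda>j. b j i) \<longlonglongrightarrow> c i"
  shows "(\<lambda>j. interp M B (tuple (map (b j) t))) \<longlonglongrightarrow> interp M B (tuple (map c t))"
proof (rule interp_tendsto[OF assms(1,2)])
  have PiE: "tuple (map g t) \<in> {..<arity L B} \<rightarrow>\<^sub>E UNIV" for g :: "'i \<Rightarrow> 'm"
    using tuple_in_PiE[of "map g t" UNIV] t by simp
  show "tuple (map c t) \<in> {..<arity L B} \<rightarrow>\<^sub>E UNIV"
    by (rule PiE)
  show "tuple (map (b j) t) \<in> {..<arity L B} \<rightarrow>\<^sub>E UNIV" for j
    by (rule PiE)
  fix i assume "i < arity L B"
  then have "t ! i \<in> set t" "\<And>g :: 'i \<Rightarrow> 'm. tuple (map g t) i = g (t ! i)"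
    using t by (simp_all add: tuple_apply)
  then show "(\<lambda>j. tuple (map (b j) t) i) \<longlonglongrightarrow> tuple (map c t) i"
    using lim by simp
qed

lemma embedding_image_domain_eq:
  assumes f: "embedding L M N f" and g: "embedding L N M g" and N: "proper N"
  shows "f ` domain M k = domain N k"
proof
  have dom: "f ` domain M k \<subseteq> domain N k" "g ` domain N k \<subseteq> domain M k"
    using f g by (simp_all add: embedding_def)
  then show "f ` domain M k \<subseteq> domain N k"
    by simp
  have "(f \<circ> g) ` domain N k = domain N k"
  proof (rule isometry_compact_onto)
    show "dist ((f \<circ> g) x) ((f \<circ> g) y) = dist x y" for x y
      using f g by (simp add: embedding_def)
    show "compact (domain N k)"
      using N by (simp add: proper_def)
    show "(f \<circ> g) ` domain N k \<subseteq> domain N k"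
      using dom by auto
  qed
  then show "domain N k \<subseteq> f ` domain M k"
    using dom(2) by (metis image_comp image_mono)
qed

lemma closure_range_sequential:
  fixes f :: "'a \<Rightarrow> 'b::first_countable_topology"
  assumes "y \<in> closure (range f)"
  obtains x where "(\<lambda>n :: nat. f (x n)) \<longlonglongrightarrow> y"
proof -
  obtain s where s: "\<And>n. s n \<in> range f" "s \<longlonglongrightarrow> y"
    using assms by (auto simp: closure_sequential)
  then have "\<exists>x. \<forall>n. s n = f (x n)"
    by (intro choice) blast
  then show thesis
    using s(2) that by (auto simp: fun_eq_iff[symmetric])
qed

text \<open>Preimages of a convergent sequence in the range form a Cauchy sequence, and completeness
  of the source supplies the missing preimage.\<close>

lemma isometry_surj:
  fixes f :: "'a::complete_space \<Rightarrow> 'b::metric_space"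
  assumes iso: "\<And>x y. dist (f x) (f y) = dist x y" and dense: "closure (range f) = UNIV"
  shows "surj f"
proof -
  have "\<exists>x. f x = y" for y
  proof -
    obtain x where x: "(\<lambda>n. f (x n)) \<longlonglongrightarrow> y"
      using dense closure_range_sequential[of y f] by auto
    then have "Cauchy (\<lambda>n. f (x n))"
      by (rule LIMSEQ_imp_Cauchy)
    then have "Cauchy x"
      unfolding Cauchy_def iso .
    then obtain l where l: "x \<longlonglongrightarrow> l"
      using Cauchy_convergent convergent_def by blast
    have "(\<lambda>n. f (x n)) \<longlonglongrightarrow> f l"
      using l unfolding tendsto_iff iso .
    then show ?thesis
      using x LIMSEQ_unique by blast
  qed
  then show ?thesis
    by (metis surj_def)
qed

lemma inj_embedding: "embedding L M N f \<Longrightarrow> inj f"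
  unfolding embedding_def inj_def by (metis dist_eq_0_iff)

text \<open>One of the two embeddings is itself the isomorphism: it maps each domain of
  \<open>M\<close> onto that of \<open>N\<close>, so its range is dense, and completeness of
  \<open>M\<close> makes it surjective.\<close>

lemma bi_embeddable_imp_isomorphic:
  assumes N: "is_structure L N" "proper N"
    and "embeds L M N" "embeds L N M"
  shows "isomorphic L M N"
proof -
  obtain f g where f: "embedding L M N f" and g: "embedding L N M g"
    using assms by (auto simp: embeds_def)
  have dom: "f ` domain M k = domain N k" for k
    using f g N(2) by (rule embedding_image_domain_eq)
  have iso: "dist (f x) (f y) = dist x y" for x y
    using f by (simp add: embedding_def)
  have "(\<Union>k. domain N k) \<subseteq> range f"
    using dom by blast
  then have "closure (range f) = UNIV"
    using N(1) closure_mono[of "\<Union>k. domain N k" "range f"] by (auto simp: is_structure_def)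
  then have surj: "surj f"
    using isometry_surj[OF iso] by blast
  then have bij: "bij f"
    using f by (simp add: bij_def inj_embedding)
  have "embedding L N M (inv f)"
    unfolding embedding_def
  proof (intro conjI allI ballI)
    show "dist (inv f x) (inv f y) = dist x y" for x y
      using iso[of "inv f x" "inv f y"] surj by (simp add: surj_f_inv_f)
    show "inv f ` domain N k \<subseteq> domain M k" for k
      using dom[of k, symmetric] bij by (simp add: bij_is_inj image_inv_f_f)
    show "interp M B (compose {..<arity L B} (inv f) x) = interp N B x"
      if "B \<in> symbols L" and x: "x \<in> {..<arity L B} \<rightarrow>\<^sub>E UNIV" for B x
    proof -
      have "compose {..<arity L B} f (compose {..<arity L B} (inv f) x) = x"
        using x surj_f_inv_f[OF surj] by (auto simp: compose_def fun_eq_iff PiE_def extensional_def)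
      moreover have "compose {..<arity L B} (inv f) x \<in> {..<arity L B} \<rightarrow>\<^sub>E UNIV"
        by (simp add: compose_def)
      ultimately show ?thesis
        using f \<open>B \<in> symbols L\<close> unfolding embedding_def by fastforce
    qed
  qed
  then show ?thesis
    using f bij by (auto simp: isomorphic_def)
qed

section \<open>Embeddings from approximate copies of finite configurations\<close>

text \<open>Membership in the prescribed domains is exact and only relation values carry a
  tolerance, so that compactness can later turn approximate copies into an exact one. Index lists
  \<open>t\<close> allow repeated points, and \<open>S\<close> may contain the metric
  symbol.\<close>

definition approx_embeds ::
  "'r language \<Rightarrow> ('r, 'm::polish_space) metric_structure \<Rightarrow> ('r, 'n::polish_space) metric_structure
     \<Rightarrow> bool" where
  "approx_embeds L M N \<longleftrightarrow>
     (\<forall>(n::nat) a k S. \<forall>\<epsilon>>0. finite S \<and> S \<subseteq> symbols L \<and> (\<forall>i<n. a i \<in> domain M (k i)) \<longrightarrow>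
        (\<exists>b. (\<forall>i<n. b i \<in> domain N (k i)) \<and>
             (\<forall>B\<in>S. \<forall>t. length t = arity L B \<and> set t \<subseteq> {..<n} \<longrightarrow>
                \<bar>interp N B (tuple (map b t)) - interp M B (tuple (map a t))\<bar> < \<epsilon>)))"

lemma approx_embedsD:
  fixes n :: nat
  assumes "approx_embeds L M N" "\<epsilon> > 0" "finite S" "S \<subseteq> symbols L"
    "\<And>i. i < n \<Longrightarrow> a i \<in> domain M (k i)"
  obtains b where "\<forall>i<n. b i \<in> domain N (k i)"
    "\<forall>B\<in>S. \<forall>t. length t = arity L B \<and> set t \<subseteq> {..<n} \<longrightarrow>
       \<bar>interp N B (tuple (map b t)) - interp M B (tuple (map a t))\<bar> < \<epsilon>"
proof -
  have "\<exists>b. (\<forall>i<n. b i \<in> domain N (k i)) \<and>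
             (\<forall>B\<in>S. \<forall>t. length t = arity L B \<and> set t \<subseteq> {..<n} \<longrightarrow>
                \<bar>interp N B (tuple (map b t)) - interp M B (tuple (map a t))\<bar> < \<epsilon>)"
    using assms unfolding approx_embeds_def by blast
  then show ?thesis
    using that by blast
qed

text \<open>Diagonal argument: stage \<open>n\<close> copies the first \<open>n\<close> points and
  respects the first \<open>n\<close> symbols up to \<open>1 / (n + 1)\<close>. Compactness of the
  product of the domains yields a limit of copies, and continuity makes its relation values
  exact.\<close>

lemma approx_embeds_limit:
  fixes a :: "nat \<Rightarrow> 'm::polish_space" and k :: "nat \<Rightarrow> nat"
  assumes ae: "approx_embeds L M N" and lang: "is_language L" "countable (symbols L)"
    and N: "is_structure L N" "proper N"
    and a: "\<And>i. a i \<in> domain M (k i)"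
  obtains b where "\<forall>i. b i \<in> domain N (k i)"
    "\<forall>B\<in>symbols L. \<forall>t. length t = arity L B \<longrightarrow>
       interp N B (tuple (map b t)) = interp M B (tuple (map a t))"
proof -
  define S where "S n = from_nat_into (symbols L) ` {..<n}" for n :: nat
  have nonempty: "symbols L \<noteq> {}"
    using lang(1) by (auto simp: is_language_def)
  have S: "finite (S n)" "S n \<subseteq> symbols L" for n
    using from_nat_into[OF nonempty] by (auto simp: S_def)
  have "\<forall>n. \<exists>b. (\<forall>i. b i \<in> domain N (k i)) \<and> (\<forall>B\<in>S n. \<forall>t. length t = arity L B \<and> set t \<subseteq> {..<n} \<longrightarrow>
      \<bar>interp N B (tuple (map b t)) - interp M B (tuple (map a t))\<bar> < inverse (Suc n))" (is "\<forall>n. \<exists>b. ?P n b")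
  proof
    fix n
    obtain b where "\<forall>i<n. b i \<in> domain N (k i)"
      "\<forall>B\<in>S n. \<forall>t. length t = arity L B \<and> set t \<subseteq> {..<n} \<longrightarrow>
         \<bar>interp N B (tuple (map b t)) - interp M B (tuple (map a t))\<bar> < inverse (Suc n)"
      by (rule approx_embedsD[OF ae _ S, of "inverse (Suc n)" n a k]) (use a in auto)
    note b = this[rule_format]
    \<comment> \<open>Stage \<open>n\<close> fixes only coordinates below \<open>n\<close>, and
      membership in the full product needs filler points for the others. A copy of the first
      \<open>i + 1\<close> points already contains a point of \<open>domain N (k i)\<close>.\<close>
    have "domain N (k i) \<noteq> {}" for i
    proof -
      show ?thesis
        by (rule approx_embedsD[OF ae zero_less_one S, of "Suc i" a k n]) (use a in auto)
    qed
    then have "\<forall>i. \<exists>x. x \<in> domain N (k i)"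
      by blast
    then obtain c where c: "\<And>i. c i \<in> domain N (k i)"
      unfolding choice_iff by blast
    define b' where "b' i = (if i < n then b i else c i)" for i
    have b': "map b' t = map b t" if "set t \<subseteq> {..<n}" for t :: "nat list"
      using that by (auto simp: b'_def)
    show "\<exists>b. ?P n b"
    proof (intro exI[of _ b'] conjI allI ballI impI; (elim conjE)?)
      show "b' i \<in> domain N (k i)" for i
        by (simp add: b'_def b(1) c)
      show "\<bar>interp N B (tuple (map b' t)) - interp M B (tuple (map a t))\<bar> < inverse (Suc n)"
        if "B \<in> S n" "length t = arity L B" "set t \<subseteq> {..<n}" for B t
        unfolding b'[OF that(3)] using that by (intro b(2)) auto
    qed
  qed
  then obtain b where "\<forall>n. ?P n (b n)"
    unfolding choice_iff by blast
  then have b: "\<And>n i. b n i \<in> domain N (k i)"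
    "\<And>n B t. B \<in> S n \<Longrightarrow> length t = arity L B \<Longrightarrow> set t \<subseteq> {..<n} \<Longrightarrow>
       \<bar>interp N B (tuple (map (b n) t)) - interp M B (tuple (map a t))\<bar> < inverse (Suc n)"
    by auto
  \<comment> \<open>Tychonoff's theorem; the index set is countable, so compactness also gives
    convergent subsequences.\<close>
  have "compactin (product_topology (\<lambda>_. euclidean) UNIV) (PiE UNIV (\<lambda>i. domain N (k i)))"
    using N(2) by (simp add: compactin_PiE proper_def)
  then have "compact (PiE UNIV (\<lambda>i. domain N (k i)))"
    by (simp add: euclidean_product_topology)
  moreover have "\<forall>n. b n \<in> PiE UNIV (\<lambda>i. domain N (k i))"
    using b(1) by auto
  ultimately obtain c r where r: "c \<in> PiE UNIV (\<lambda>i. domain N (k i))" "strict_mono (r :: nat \<Rightarrow> nat)"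
    "(b \<circ> r) \<longlonglongrightarrow> c"
    by (rule seq_compactE[OF compact_imp_seq_compact])
  have lim: "(\<lambda>j. b (r j) i) \<longlonglongrightarrow> c i" for i
    using continuous_on_tendsto_compose[OF continuous_on_product_coordinates[of i] r(3)]
    by (simp add: o_def)
  show thesis
  proof (rule that; intro allI ballI impI)
    show "c i \<in> domain N (k i)" for i
      using r(1) by auto
    fix B and t :: "nat list" assume B: "B \<in> symbols L" and t: "length t = arity L B"
    have "(\<lambda>j. interp N B (tuple (map (b (r j)) t))) \<longlonglongrightarrow> interp N B (tuple (map c t))"
      using N(1) B t lim by (rule interp_tuple_tendsto)
    moreover have "(\<lambda>j. interp N B (tuple (map (b (r j)) t)) - interp M B (tuple (map a t))) \<longlonglongrightarrow> 0"
    proof (rule Lim_null_comparison)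
      obtain n where n: "B = from_nat_into (symbols L) n"
        using from_nat_into_surj[OF lang(2) B] by blast
      \<comment> \<open>Exceeds no stage after \<open>m\<close>: both the position of
        \<open>B\<close> in the enumeration and all entries of \<open>t\<close> are at most
        \<open>m\<close>, so every stage from \<open>Suc m\<close> on controls this value.\<close>
      define m where "m = Max (insert n (set t))"
      have m: "n \<le> m" "set t \<subseteq> {..m}"
        by (auto simp: m_def)
      have "\<bar>interp N B (tuple (map (b (r j)) t)) - interp M B (tuple (map a t))\<bar> \<le> inverse (Suc j)"
        if "j \<ge> Suc m" for j
      proof -
        have j: "j \<le> r j"
          using r(2) by (rule seq_suble)
        have "B \<in> S (r j)"
          using n m that j by (auto simp: S_def)
        then have "\<bar>interp N B (tuple (map (b (r j)) t)) - interp M B (tuple (map a t))\<bar>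
            < inverse (Suc (r j))"
          using m that j t by (intro b(2)) auto
        also have "\<dots> \<le> inverse (Suc j)"
          using j by (simp add: field_simps)
        finally show ?thesis by simp
      qed
      then show "\<forall>\<^sub>F j in sequentially. norm (interp N B (tuple (map (b (r j)) t))
          - interp M B (tuple (map a t))) \<le> inverse (real (Suc j))"
        unfolding eventually_sequentially real_norm_def by blast
      show "(\<lambda>j. inverse (real (Suc j))) \<longlonglongrightarrow> 0"
        by (rule LIMSEQ_inverse_real_of_nat)
    qed
    ultimately show "interp N B (tuple (map c t)) = interp M B (tuple (map a t))"
      by (rule LIMSEQ_unique[OF _ LIM_zero_cancel])
  qed
qed

text \<open>A single sequence has to serve all domains, so pairs of a domain index and a point of a
  countable dense subset are enumerated. The label \<open>k i\<close> remembers the domain for which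
  \<open>a i\<close> was chosen; density is needed within each domain, not merely in the whole
  space.\<close>

lemma countable_indexed_dense:
  fixes M :: "('r, 'm::polish_space) metric_structure"
  assumes "is_structure L M"
  obtains a :: "nat \<Rightarrow> 'm" and k where "\<forall>i. a i \<in> domain M (k i)"
    "\<forall>j. domain M j \<subseteq> closure {a i | i. k i = j}"
proof -
  have "\<forall>j. \<exists>C. countable C \<and> C \<subseteq> domain M j \<and> domain M j \<subseteq> closure C"
    using separable by meson
  then obtain C where "\<forall>j. countable (C j) \<and> C j \<subseteq> domain M j \<and> domain M j \<subseteq> closure (C j)"
    unfolding choice_iff by blast
  then have C: "\<And>j. countable (C j)" "\<And>j. C j \<subseteq> domain M j" "\<And>j. domain M j \<subseteq> closure (C j)"
    by auto
  define P where "P = (SIGMA j:UNIV. C j)"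
  have cP: "countable P"
    using C(1) by (simp add: P_def)
  \<comment> \<open>Otherwise all domains would be empty, while their union is dense in a nonempty
    space.\<close>
  have "P \<noteq> {}"
  proof
    assume "P = {}"
    then have "C j = {}" for j
      by (auto simp: P_def)
    then have "domain M j = {}" for j
      using C(3)[of j] by simp
    then show False
      using assms by (simp add: is_structure_def)
  qed
  then have in_P: "from_nat_into P i \<in> P" for i
    by (rule from_nat_into)
  show thesis
  proof (rule that; intro allI)
    show "snd (from_nat_into P i) \<in> domain M (fst (from_nat_into P i))" for i
      using in_P[of i] C(2) by (auto simp: P_def mem_Times_iff subset_iff split: prod.splits)
    show "domain M j \<subseteq> closure {snd (from_nat_into P i) | i. fst (from_nat_into P i) = j}" for j
    proof -
      have "C j \<subseteq> {snd (from_nat_into P i) | i. fst (from_nat_into P i) = j}"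
      proof
        fix x assume "x \<in> C j"
        then have "(j, x) \<in> P"
          by (simp add: P_def)
        then obtain i where "from_nat_into P i = (j, x)"
          using from_nat_into_surj[OF cP] by blast
        then show "x \<in> {snd (from_nat_into P i) | i. fst (from_nat_into P i) = j}"
          by (intro CollectI exI[of _ i]) simp
      qed
      then show ?thesis
        using C(3) closure_mono by blast
    qed
  qed
qed

lemma isometric_extension:
  fixes a :: "'i \<Rightarrow> 'a::metric_space" and b :: "'i \<Rightarrow> 'b::complete_space"
  assumes dist_ab: "\<And>i j. dist (b i) (b j) = dist (a i) (a j)" and dense: "closure (range a) = UNIV"
  obtains f where "continuous_on UNIV f" "\<And>i. f (a i) = b i"
proof -
  \<comment> \<open>The sequence \<open>a\<close> may repeat a point; equal points have images at
    distance 0, so the chosen index does not affect the value.\<close>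
  define g where "g p = b (SOME i. a i = p)" for p
  have ga: "g (a i) = b i" for i
  proof -
    have "a (SOME j. a j = a i) = a i"
      by (rule someI) (rule refl)
    then have "dist (g (a i)) (b i) = 0"
      unfolding g_def dist_ab by simp
    then show ?thesis by simp
  qed
  have "uniformly_continuous_on (range a) g"
    unfolding uniformly_continuous_on_def by (auto simp: ga dist_ab)
  then show thesis
  proof (rule uniformly_continuous_on_extension_on_closure)
    fix f assume f: "uniformly_continuous_on (closure (range a)) f" "\<And>x. x \<in> range a \<Longrightarrow> g x = f x"
    show thesis
    proof
      show "continuous_on UNIV f"
        using f(1) dense by (simp add: uniformly_continuous_imp_continuous)
      show "f (a i) = b i" for i
        using f(2)[of "a i"] ga[of i] by simp
    qed
  qed
qed

text \<open>The metric is one of the relations, so the exact copy \<open>b\<close> of the dense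
  sequence \<open>a\<close> is isometric and extends continuously. Each clause of
  \<open>embedding\<close> then passes to limits from the points \<open>a i\<close>.\<close>

lemma approx_embeds_imp_embeds:
  fixes M :: "('r, 'm::polish_space) metric_structure" and N :: "('r, 'n::polish_space) metric_structure"
  assumes ae: "approx_embeds L M N" and lang: "is_language L" "countable (symbols L)"
    and M: "is_structure L M" and N: "is_structure L N" "proper N"
  shows "embeds L M N"
proof -
  obtain a :: "nat \<Rightarrow> 'm" and k where "\<forall>i. a i \<in> domain M (k i)"
    "\<forall>j. domain M j \<subseteq> closure {a i | i. k i = j}"
    by (rule countable_indexed_dense[OF M])
  note a = this[rule_format]
  obtain b where "\<forall>i. b i \<in> domain N (k i)"
    "\<forall>B\<in>symbols L. \<forall>t. length t = arity L B \<longrightarrow>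
       interp N B (tuple (map b t)) = interp M B (tuple (map a t))"
    by (rule approx_embeds_limit[OF ae lang N a(1)])
  note b = this[rule_format]
  have dist_ab: "dist (b i) (b j) = dist (a i) (a j)" for i j
    using b(2)[of "metric_symbol L" "[i, j]"] lang(1) M N(1)
    by (simp add: is_language_def interp_metric_symbol)
  have closure_a: "closure (range a) = UNIV"
  proof -
    have "domain M j \<subseteq> closure (range a)" for j
      using a(2)[of j] closure_mono[of "{a i |i. k i = j}" "range a"] by blast
    then have closure_a: "closure (\<Union>j. domain M j) \<subseteq> closure (range a)"
      by (intro closure_minimal) auto
    then show ?thesis
      using M by (simp add: is_structure_def top.extremum_uniqueI)
  qed
  obtain f where cont: "continuous_on UNIV f" and fa: "\<And>i. f (a i) = b i"
    using isometric_extension[OF dist_ab closure_a] by blast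
  have f_lim: "(\<lambda>j. f (s j)) \<longlonglongrightarrow> f x" if "s \<longlonglongrightarrow> x" for s :: "nat \<Rightarrow> 'm" and x
    using continuous_on_tendsto_compose[OF cont that] by simp
  have "\<exists>\<iota>. (\<lambda>j. a (\<iota> j)) \<longlonglongrightarrow> x" for x
  proof -
    have "x \<in> closure (range a)"
      by (simp add: closure_a)
    then show ?thesis
      using closure_range_sequential by blast
  qed
  then have "\<forall>x. \<exists>\<iota>. (\<lambda>j. a (\<iota> j)) \<longlonglongrightarrow> x"
    by blast
  then obtain \<iota> where \<iota>: "\<And>x. (\<lambda>j. a (\<iota> x j)) \<longlonglongrightarrow> x"
    unfolding choice_iff by blast
  have \<iota>b: "(\<lambda>j. b (\<iota> x j)) \<longlonglongrightarrow> f x" for x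
    using f_lim[OF \<iota>[of x]] by (simp add: fa)
  have "embedding L M N f"
    unfolding embedding_def
  proof (intro conjI allI ballI)
    fix x y
    have "(\<lambda>j. dist (b (\<iota> x j)) (b (\<iota> y j))) \<longlonglongrightarrow> dist (f x) (f y)"
      by (intro tendsto_dist \<iota>b)
    moreover have "(\<lambda>j. dist (a (\<iota> x j)) (a (\<iota> y j))) \<longlonglongrightarrow> dist x y"
      by (intro tendsto_dist \<iota>)
    ultimately show "dist (f x) (f y) = dist x y"
      unfolding dist_ab by (rule LIMSEQ_unique)
  next
    fix j
    \<comment> \<open>Points labelled \<open>j\<close> are dense in \<open>domain M j\<close> and go
      into the closed set \<open>domain N j\<close>; continuity carries this over to their
      closure.\<close>
    have "closed (domain N j)"
      using N(1) by (simp add: is_structure_def)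
    moreover have "f ` {a i | i. k i = j} \<subseteq> domain N j"
      using b(1) fa by auto
    ultimately have "f ` closure {a i | i. k i = j} \<subseteq> domain N j"
      using cont by (intro image_closure_subset) (auto intro: continuous_on_subset)
    then show "f ` domain M j \<subseteq> domain N j"
      using a(2)[of j] by blast
  next
    fix B and x :: "nat \<Rightarrow> 'm" assume B: "B \<in> symbols L" and x: "x \<in> {..<arity L B} \<rightarrow>\<^sub>E UNIV"
    \<comment> \<open>The \<open>j\<close>-th index list names points of the sequence that
      approximate the coordinates of \<open>x\<close> simultaneously.\<close>
    define t where "t j = map (\<lambda>i. \<iota> (x i) j) [0..<arity L B]" for j
    have t: "length (t j) = arity L B" for j
      by (simp add: t_def)
    have PiE: "tuple (map c (t j)) \<in> {..<arity L B} \<rightarrow>\<^sub>E UNIV" for c :: "nat \<Rightarrow> 'c::polish_space" and j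
      using tuple_in_PiE[of "map c (t j)" UNIV] t by simp
    have apply_t: "tuple (map c (t j)) i = c (\<iota> (x i) j)" if "i < arity L B"
      for c :: "nat \<Rightarrow> 'c::polish_space" and i j
      using that by (simp add: tuple_apply t_def)
    have "(\<lambda>j. interp M B (tuple (map a (t j)))) \<longlonglongrightarrow> interp M B x"
      by (rule interp_tendsto[OF M B x PiE]) (simp add: apply_t \<iota>)
    moreover have "(\<lambda>j. interp N B (tuple (map b (t j)))) \<longlonglongrightarrow> interp N B (compose {..<arity L B} f x)"
      by (rule interp_tendsto[OF N(1) B _ PiE]) (simp_all add: apply_t \<iota>b compose_def)
    ultimately show "interp N B (compose {..<arity L B} f x) = interp M B x"
      unfolding b(2)[OF B t] using LIMSEQ_unique by blast
  qed
  then show ?thesis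
    by (auto simp: embeds_def)
qed

section \<open>Values of sentences\<close>

lemma isomorphicE:
  assumes "isomorphic L M N"
  obtains f where "bij f" "embedding L M N f" "embedding L N M (inv f)" "\<forall>k. f ` domain M k = domain N k"
proof -
  obtain f where f: "bij f" "embedding L M N f" "embedding L N M (inv f)"
    using assms by (auto simp: isomorphic_def)
  have "f ` domain M k = domain N k" for k
  proof
    show "f ` domain M k \<subseteq> domain N k"
      using f(2) by (simp add: embedding_def)
    have "inv f ` domain N k \<subseteq> domain M k"
      using f(3) by (simp add: embedding_def)
    then have "f ` inv f ` domain N k \<subseteq> f ` domain M k"
      by (rule image_mono)
    then show "domain N k \<subseteq> f ` domain M k"
      using f(1) by (simp add: bij_is_surj image_f_inv_f)
  qed
  with f that show thesis
    by blast
qed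

lemma isomorphic_imp_embeds:
  assumes "isomorphic L M N"
  shows "embeds L M N" "embeds L N M"
  using assms by (auto simp: isomorphic_def embeds_def)

text \<open>Since \<open>f\<close> maps domains onto domains, each quantifier in \<open>N\<close>
  runs over the same set of values as in \<open>M\<close>, which settles suprema and infima
  alike.\<close>

lemma eval_embedding:
  assumes f: "embedding L M N f" and onto: "\<And>k. f ` domain M k = domain N k"
    and "wf_formula L \<phi>"
  shows "eval N (f \<circ> \<sigma>) \<phi> = eval M \<sigma> \<phi>"
  using \<open>wf_formula L \<phi>\<close>
proof (induction \<phi> arbitrary: \<sigma>)
  case (Atom B xs)
  then have B: "B \<in> symbols L" and len: "length (map \<sigma> xs) = arity L B"
    by auto
  have "interp N B (compose {..<arity L B} f (tuple (map \<sigma> xs))) = interp M B (tuple (map \<sigma> xs))"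
    using f B tuple_in_PiE[of "map \<sigma> xs" UNIV] len unfolding embedding_def by simp
  then show ?case
    using compose_tuple[of "map \<sigma> xs" f] len by (simp add: o_def)
next
  case (Conn u \<phi>s)
  then have "map (eval N (f \<circ> \<sigma>)) \<phi>s = map (eval M \<sigma>) \<phi>s"
    by (intro map_cong[OF refl] Conn.IH) auto
  then show ?case
    by (simp only: eval.simps)
next
  case (QSup k x \<phi>)
  have "(\<lambda>a. eval N ((f \<circ> \<sigma>)(x := a)) \<phi>) ` domain N k = (\<lambda>a. eval M (\<sigma>(x := a)) \<phi>) ` domain M k"
    unfolding onto[symmetric] image_image fun_upd_comp[symmetric]
    using QSup.prems by (intro image_cong[OF refl] QSup.IH) simp
  moreover have "domain N k = {} \<longleftrightarrow> domain M k = {}"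
    unfolding onto[symmetric] by simp
  ultimately show ?case
    by (simp add: o_def)
next
  case (QInf k x \<phi>)
  have "(\<lambda>a. eval N ((f \<circ> \<sigma>)(x := a)) \<phi>) ` domain N k = (\<lambda>a. eval M (\<sigma>(x := a)) \<phi>) ` domain M k"
    unfolding onto[symmetric] image_image fun_upd_comp[symmetric]
    using QInf.prems by (intro image_cong[OF refl] QInf.IH) simp
  moreover have "domain N k = {} \<longleftrightarrow> domain M k = {}"
    unfolding onto[symmetric] by simp
  ultimately show ?case
    by (simp add: o_def)
qed

lemma isomorphic_imp_sentence_value_eq:
  assumes iso: "isomorphic L M N" and \<phi>: "sentence L \<phi>"
  shows "sentence_value M \<phi> = sentence_value N \<phi>"
proof -
  obtain f where f: "embedding L M N f" "\<forall>k. f ` domain M k = domain N k"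
    using iso by (rule isomorphicE)
  have "eval N (f \<circ> (\<lambda>_. undefined)) \<phi> = eval M (\<lambda>_. undefined) \<phi>"
    using \<phi> f(2) by (intro eval_embedding[OF f(1)]) (auto simp: sentence_def)
  \<comment> \<open>The map \<open>f\<close> need not send the default point of \<open>M\<close> to
    that of \<open>N\<close>, but a sentence does not see the assignment.\<close>
  moreover have "eval N (f \<circ> (\<lambda>_. undefined)) \<phi> = eval N (\<lambda>_. undefined) \<phi>"
    using \<phi> by (intro eval_cong_free_vars) (simp add: sentence_def)
  ultimately show ?thesis
    by (simp add: sentence_value_def)
qed

text \<open>Applying a negating connective outside would leave the quantifiers as they are. Instead
  negation is pushed down to the atoms: quantifiers are exchanged and \<open>u\<close> becomes its
  dual, the map from \<open>v\<close> to \<open>- u (- v)\<close>. The restriction keeps the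
  argument of \<open>u\<close> an extensional tuple.\<close>

fun negate :: "'r formula \<Rightarrow> 'r formula" where
  "negate (Atom B xs) = Conn (\<lambda>v. - v 0) [Atom B xs]"
| "negate (Conn u \<phi>s) = Conn (\<lambda>v. - u (\<lambda>i\<in>{..<length \<phi>s}. - v i)) (map negate \<phi>s)"
| "negate (QSup k x \<phi>) = QInf k x (negate \<phi>)"
| "negate (QInf k x \<phi>) = QSup k x (negate \<phi>)"

lemma existential_negate: "existential (negate \<phi>) \<longleftrightarrow> universal \<phi>"
  by (induction \<phi>) auto

lemma free_vars_negate: "free_vars (negate \<phi>) = free_vars \<phi>"
  by (induction \<phi>) auto

lemma wf_formula_negate:
  assumes "wf_formula L \<phi>"
  shows "wf_formula L (negate \<phi>)"
  using assms
proof (induction \<phi>)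
  case (Atom B xs)
  then show ?case
    by (auto intro!: continuous_map_minus continuous_map_product_projection)
next
  case (Conn u \<phi>s)
  let ?X = "product_topology (\<lambda>_. euclideanreal) {..<length \<phi>s}"
  have "continuous_map ?X ?X (\<lambda>v. \<lambda>i\<in>{..<length \<phi>s}. - v i)"
    by (auto simp: continuous_map_componentwise
        intro!: continuous_map_minus continuous_map_product_projection)
  moreover have "continuous_map ?X euclideanreal u"
    using Conn.prems by simp
  ultimately have "continuous_map ?X euclideanreal (u \<circ> (\<lambda>v. \<lambda>i\<in>{..<length \<phi>s}. - v i))"
    by (rule continuous_map_compose)
  then have "continuous_map ?X euclideanreal (\<lambda>v. - u (\<lambda>i\<in>{..<length \<phi>s}. - v i))"
    unfolding o_def by (rule continuous_map_minus)
  then show ?case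
    using Conn by auto
qed auto

lemma eval_negate: "eval M \<sigma> (negate \<phi>) = - eval M \<sigma> \<phi>"
proof (induction \<phi> arbitrary: \<sigma>)
  case (Atom B xs)
  then show ?case
    by (simp add: tuple_apply)
next
  case (Conn u \<phi>s)
  then have "(\<lambda>i\<in>{..<length \<phi>s}. - tuple (map (eval M \<sigma>) (map negate \<phi>s)) i) = tuple (map (eval M \<sigma>) \<phi>s)"
    by (auto simp: tuple_def restrict_def fun_eq_iff)
  then show ?case
    by simp
next
  \<comment> \<open>The real \<open>Inf\<close> is the negated \<open>Sup\<close> of the negated
    set, and over an empty domain both quantifiers give 0, which equals its own negative.\<close>
  case (QSup k x \<phi>)
  then show ?case
    by (simp add: Inf_real_def image_image fun_upd_def)
next
  case (QInf k x \<phi>)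
  then show ?case
    by (simp add: Inf_real_def image_image fun_upd_def)
qed

lemma existential_eq_imp_universal_eq:
  assumes eq: "\<forall>\<phi>. sentence L \<phi> \<and> existential \<phi> \<longrightarrow> sentence_value M \<phi> = sentence_value N \<phi>"
    and "sentence L \<phi>" "universal \<phi>"
  shows "sentence_value M \<phi> = sentence_value N \<phi>"
proof -
  have "sentence L (negate \<phi>)"
    using assms(2) by (simp add: sentence_def wf_formula_negate free_vars_negate)
  then have "sentence_value M (negate \<phi>) = sentence_value N (negate \<phi>)"
    using eq assms(3) by (simp add: existential_negate)
  then show ?thesis
    by (simp add: sentence_value_def eval_negate)
qed

section \<open>Detecting configurations by universal sentences\<close>

text \<open>Variable 0 is bound outermost and variable \<open>n - 1\<close> innermost, so inductions
  on \<open>n\<close> generalize over the formula.\<close>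

primrec sup_block :: "(nat \<Rightarrow> nat) \<Rightarrow> nat \<Rightarrow> 'r formula \<Rightarrow> 'r formula" where
  "sup_block k 0 \<phi> = \<phi>"
| "sup_block k (Suc n) \<phi> = sup_block k n (QSup (k n) n \<phi>)"

text \<open>Describes the situation inside a quantifier block. It serves both for assignments of
  points and for contexts of domain indices, where \<open>k\<close> replaces the outer
  context.\<close>

definition override_below :: "nat \<Rightarrow> (nat \<Rightarrow> 'a) \<Rightarrow> (nat \<Rightarrow> 'a) \<Rightarrow> nat \<Rightarrow> 'a" where
  "override_below n b \<sigma> = (\<lambda>i. if i < n then b i else \<sigma> i)"

lemma override_below_0 [simp]: "override_below 0 b \<sigma> = \<sigma>"
  by (simp add: override_below_def)

lemma override_below_upd: "(override_below n b \<sigma>)(n := x) = override_below (Suc n) (b(n := x)) \<sigma>"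
  by (auto simp: override_below_def fun_eq_iff)

lemma free_vars_sup_block: "free_vars (sup_block k n \<phi>) = free_vars \<phi> - {..<n}"
  by (induction n arbitrary: \<phi>) (auto simp: lessThan_Suc)

lemma wf_formula_sup_block: "wf_formula L (sup_block k n \<phi>) \<longleftrightarrow> wf_formula L \<phi>"
  by (induction n arbitrary: \<phi>) auto

lemma universal_sup_block: "universal (sup_block k n \<phi>) \<longleftrightarrow> universal \<phi>"
  by (induction n arbitrary: \<phi>) auto

lemma restricted_in_sup_block:
  "restricted_in L F c (sup_block k n \<phi>) \<longleftrightarrow> restricted_in L F (override_below n k c) \<phi>"
  by (induction n arbitrary: \<phi>) (simp_all add: override_below_upd)

text \<open>The points \<open>a i\<close> are admissible choices for the nested suprema. The common
  bound \<open>K\<close> ensures that these real suprema really dominate their values.\<close>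

lemma eval_le_eval_sup_block:
  assumes "\<And>\<tau>. eval M \<tau> \<phi> \<le> K" and "\<And>i. i < n \<Longrightarrow> a i \<in> domain M (k i)"
  shows "eval M (override_below n a \<sigma>) \<phi> \<le> eval M \<sigma> (sup_block k n \<phi>)"
  using assms
proof (induction n arbitrary: \<phi> K)
  case 0
  then show ?case
    by simp
next
  case (Suc n)
  have bdd: "bdd_above ((\<lambda>x. eval M (\<tau>(n := x)) \<phi>) ` domain M (k n))" for \<tau>
    using Suc.prems(1) by (auto intro!: bdd_aboveI2)
  have an: "a n \<in> domain M (k n)"
    using Suc.prems(2) by simp
  have "eval M (override_below (Suc n) a \<sigma>) \<phi> = eval M ((override_below n a \<sigma>)(n := a n)) \<phi>"
    unfolding override_below_upd by simp
  also have "\<dots> \<le> eval M (override_below n a \<sigma>) (QSup (k n) n \<phi>)"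
    using an by (auto intro!: cSUP_upper bdd)
  also have "\<dots> \<le> eval M \<sigma> (sup_block k n (QSup (k n) n \<phi>))"
  proof (rule Suc.IH)
    \<comment> \<open>The domain contains \<open>a n\<close>, so the default value 0 does not arise
      and the bound \<open>K\<close> is inherited.\<close>
    show "eval M \<tau> (QSup (k n) n \<phi>) \<le> K" for \<tau>
      using an Suc.prems(1) by (auto intro: cSUP_least)
  qed (use Suc.prems(2) in simp)
  finally show ?case
    by simp
qed

text \<open>Nonnegativity of \<open>c\<close> excludes the value \<open>0\<close> of a supremum over an empty domain.\<close>

lemma eval_sup_block_witness:
  assumes "c < eval M \<sigma> (sup_block k n \<phi>)" "0 \<le> c"
  shows "\<exists>b. (\<forall>i<n. b i \<in> domain M (k i)) \<and> c < eval M (override_below n b \<sigma>) \<phi>"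
  using assms(1)
proof (induction n arbitrary: \<phi>)
  case 0
  then show ?case
    by simp
next
  case (Suc n)
  obtain b where b: "\<forall>i<n. b i \<in> domain M (k i)"
    "c < eval M (override_below n b \<sigma>) (QSup (k n) n \<phi>)"
    using Suc.IH[of "QSup (k n) n \<phi>"] Suc.prems by auto
  then have "domain M (k n) \<noteq> {}"
    using assms(2) by auto
  with b(2) obtain x where x: "x \<in> domain M (k n)" "c < eval M ((override_below n b \<sigma>)(n := x)) \<phi>"
    using less_cSupE[of c "(\<lambda>x. eval M ((override_below n b \<sigma>)(n := x)) \<phi>) ` domain M (k n)"] by auto
  have "\<forall>i<Suc n. (b(n := x)) i \<in> domain M (k i)"
    using b(1) x(1) by (simp add: less_Suc_eq)
  with x(2) show ?case
    unfolding override_below_upd by blast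
qed

section \<open>Bump connectives on cubes\<close>

lemma continuous_map_cube_projection:
  "i < m \<Longrightarrow> continuous_map (cube_topology q m) euclideanreal (\<lambda>v. v i)"
  using continuous_map_product_projection[of i "{..<m}" "\<lambda>_. top_of_set {- real q..real q}"]
  by (simp add: continuous_map_in_subtopology)

text \<open>Composition with the clamp extends a connective on the cube to a bounded total one.\<close>

definition clamp_cube :: "nat \<Rightarrow> nat \<Rightarrow> (nat \<Rightarrow> real) \<Rightarrow> nat \<Rightarrow> real" where
  "clamp_cube q m v = (\<lambda>i\<in>{..<m}. max (- real q) (min (real q) (v i)))"

lemma clamp_cube_in_topspace: "clamp_cube q m v \<in> topspace (cube_topology q m)"
  by (auto simp: clamp_cube_def)

lemma clamp_cube_id: "v \<in> topspace (cube_topology q m) \<Longrightarrow> clamp_cube q m v = v"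
  by (fastforce simp: clamp_cube_def fun_eq_iff PiE_iff extensional_def)

lemma continuous_map_clamp_cube:
  "continuous_map (product_topology (\<lambda>_. euclideanreal) {..<m}) (cube_topology q m) (clamp_cube q m)"
  by (auto simp: continuous_map_componentwise clamp_cube_def continuous_map_in_subtopology
      intro!: continuous_map_real_max continuous_map_real_min continuous_map_product_projection)

lemma dense_connectivesE:
  assumes F: "dense_connectives F" and q: "q \<ge> 1" and \<epsilon>: "\<epsilon> > 0"
    and h: "continuous_map (cube_topology q m) (top_of_set {- real q..real q}) h"
  obtains g where "g \<in> F q m" "\<forall>v\<in>topspace (cube_topology q m). \<bar>g v - h v\<bar> < \<epsilon>"
    "continuous_map (cube_topology q m) (top_of_set {- real q..real q}) g"
proof -
  have "(\<forall>g\<in>F q m. continuous_map (cube_topology q m) (top_of_set {- real q..real q}) g) \<and>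
      (\<forall>h. continuous_map (cube_topology q m) (top_of_set {- real q..real q}) h \<longrightarrow>
        (\<forall>\<epsilon>>0. \<exists>g\<in>F q m. \<forall>v\<in>topspace (cube_topology q m). \<bar>g v - h v\<bar> < \<epsilon>))"
    by (rule F[unfolded dense_connectives_def, THEN spec, THEN mp, OF q, THEN spec, of m, THEN conjunct2])
  with h \<epsilon> that show thesis
    by blast
qed

text \<open>A bump of height \<epsilon> at \<open>c\<close> is approximated within
  \<open>\<epsilon> / 4\<close>. At \<open>c\<close> the result exceeds
  \<open>3 * \<epsilon> / 4\<close>, and wherever it exceeds \<open>\<epsilon> / 2\<close> the bump
  is positive, so \<open>\<epsilon> / 2\<close> separates the two cases.\<close>

lemma dense_connectives_bump:
  assumes F: "dense_connectives F" and q: "q \<ge> 1" "\<epsilon> \<le> real q" and \<epsilon>: "\<epsilon> > 0"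
    and c: "\<And>i. i < m \<Longrightarrow> \<bar>c i\<bar> + \<epsilon> \<le> real q"
  obtains u where
    "continuous_map (product_topology (\<lambda>_. euclideanreal) {..<m}) euclideanreal u"
    "\<exists>g\<in>F q m. \<forall>v\<in>topspace (cube_topology q m). u v = g v"
    "\<forall>v. u v \<le> real q"
    "\<epsilon> / 2 < u (restrict c {..<m})"
    "\<forall>w. \<epsilon> / 2 < u w \<longrightarrow> (\<forall>i<m. \<bar>w i - c i\<bar> < \<epsilon>)"
proof -
  define h where "h v = max 0 (\<epsilon> - (\<Sum>i<m. \<bar>v i - c i\<bar>))" for v
  have h_le: "h v \<le> \<epsilon>" "0 \<le> h v" for v
    using \<epsilon> by (auto simp: h_def sum_nonneg)
  have "continuous_map (cube_topology q m) euclideanreal h"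
    unfolding h_def
    by (intro continuous_map_real_max continuous_map_diff continuous_map_sum continuous_map_real_abs
        continuous_map_cube_projection) auto
  moreover have "h v \<in> {- real q..real q}" for v
    using h_le[of v] q(2) by auto
  ultimately have "continuous_map (cube_topology q m) (top_of_set {- real q..real q}) h"
    by (auto simp: continuous_map_in_subtopology)
  moreover have "\<epsilon> / 4 > 0"
    using \<epsilon> by simp
  ultimately obtain g where g: "g \<in> F q m"
    "\<forall>v\<in>topspace (cube_topology q m). \<bar>g v - h v\<bar> < \<epsilon> / 4"
    "continuous_map (cube_topology q m) (top_of_set {- real q..real q}) g"
    using dense_connectivesE[OF F q(1)] by metis
  define u where "u v = g (clamp_cube q m v)" for v
  have u_h: "\<bar>u v - h (clamp_cube q m v)\<bar> < \<epsilon> / 4" for v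
    unfolding u_def by (rule g(2)[rule_format, OF clamp_cube_in_topspace])
  have "g v \<in> {- real q..real q}" if "v \<in> topspace (cube_topology q m)" for v
    using g(3) that unfolding continuous_map_in_subtopology by blast
  then have u_le: "u v \<le> real q" for v
    using clamp_cube_in_topspace[of q m v] unfolding u_def atLeastAtMost_iff by blast
  have u_cont: "continuous_map (product_topology (\<lambda>_. euclideanreal) {..<m}) euclideanreal u"
    using continuous_map_compose[OF continuous_map_clamp_cube g(3)]
    by (simp add: continuous_map_in_subtopology u_def[abs_def] o_def)
  have u_g: "u v = g v" if "v \<in> topspace (cube_topology q m)" for v
    unfolding u_def clamp_cube_id[OF that] ..
  have "clamp_cube q m (restrict c {..<m}) i = c i" if "i < m" for i
    using c[OF that] that \<epsilon> by (auto simp: clamp_cube_def)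
  then have "h (clamp_cube q m (restrict c {..<m})) = \<epsilon>"
    using \<epsilon> by (simp add: h_def)
  then have center: "\<epsilon> / 2 < u (restrict c {..<m})"
    using u_h[of "restrict c {..<m}"] \<epsilon> by linarith
  have close: "\<bar>w i - c i\<bar> < \<epsilon>" if w: "\<epsilon> / 2 < u w" and i: "i < m" for w i
  proof -
    have "0 < h (clamp_cube q m w)"
      using w u_h[of w] \<epsilon> by linarith
    then have "(\<Sum>i<m. \<bar>clamp_cube q m w i - c i\<bar>) < \<epsilon>"
      by (auto simp: h_def)
    moreover have "\<bar>clamp_cube q m w i - c i\<bar> \<le> (\<Sum>i<m. \<bar>clamp_cube q m w i - c i\<bar>)"
      using i by (intro member_le_sum) auto
    ultimately have "\<bar>clamp_cube q m w i - c i\<bar> < \<epsilon>"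
      by simp
    \<comment> \<open>If clamping changed \<open>w i\<close>, the clamped value would be an endpoint
      of the interval, at distance at least \<epsilon> from \<open>c i\<close> because
      \<open>\<bar>c i\<bar> + \<epsilon> \<le> real q\<close>.\<close>
    then show ?thesis
      using c[OF i] i by (auto simp: clamp_cube_def max_def min_def split: if_splits)
  qed
  show thesis
    using u_cont u_le center close g(1) u_g by (intro that[of u]) blast+
qed

text \<open>All variables of the atoms lie below \<open>n\<close>, so the outer assignment drops out
  and \<open>u\<close> sees exactly the vector of relation values of \<open>b\<close>.\<close>

lemma eval_Conn_atoms:
  assumes "\<forall>(B, t)\<in>set ps. set t \<subseteq> {..<n}"
  shows "eval M (override_below n b \<sigma>) (Conn u (map (\<lambda>(B, t). Atom B t) ps)) =
    u (\<lambda>i\<in>{..<length ps}. interp M (fst (ps ! i)) (tuple (map b (snd (ps ! i)))))"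
proof -
  have t: "map (override_below n b \<sigma>) (snd (ps ! i)) = map b (snd (ps ! i))" if "i < length ps" for i
  proof -
    have "ps ! i \<in> set ps"
      using that by simp
    then have "set (snd (ps ! i)) \<subseteq> {..<n}"
      using assms by (auto simp: case_prod_unfold)
    then show ?thesis
      by (auto simp: override_below_def)
  qed
  have "map (eval M (override_below n b \<sigma>)) (map (\<lambda>(B, t). Atom B t) ps) =
      map (\<lambda>(B, t). interp M B (tuple (map b t))) ps"
    by (rule nth_equalityI) (simp_all add: case_prod_unfold t)
  moreover have "tuple (map (\<lambda>(B, t). interp M B (tuple (map b t))) ps) =
      (\<lambda>i\<in>{..<length ps}. interp M (fst (ps ! i)) (tuple (map b (snd (ps ! i)))))"
    unfolding tuple_def[of "map (\<lambda>(B, t). interp M B (tuple (map b t))) ps"] length_map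
    by (rule restrict_ext) (simp add: case_prod_unfold)
  ultimately show ?thesis
    by (simp only: eval.simps)
qed

text \<open>One bump connective is applied to all atoms \<open>B(t)\<close> in question at once,
  under a block of suprema over the prescribed domains. The points \<open>a\<close> push the value
  in \<open>M\<close> above \<open>\<epsilon> / 2\<close>; equality of values yields witnesses in
  \<open>N\<close>.\<close>

lemma restricted_universal_imp_approx_embeds:
  fixes M :: "('r, 'm::polish_space) metric_structure" and N :: "('r, 'n::polish_space) metric_structure"
  assumes F: "dense_connectives F"
    and eq: "\<forall>\<phi>. restricted_sentence L F \<phi> \<and> universal \<phi> \<longrightarrow> sentence_value M \<phi> = sentence_value N \<phi>"
  shows "approx_embeds L M N"
  unfolding approx_embeds_def
proof (intro allI impI; elim conjE)
  fix n :: nat and a k and S :: "'r set" and \<epsilon> :: real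
  assume \<epsilon>: "\<epsilon> > 0" and S: "finite S" "S \<subseteq> symbols L" and a: "\<forall>i<n. a i \<in> domain M (k i)"
  have "finite (SIGMA B:S. {t. set t \<subseteq> {..<n} \<and> length t = arity L B})"
    using S(1) by (intro finite_SigmaI finite_lists_length_eq) auto
  then obtain ps where ps: "set ps = (SIGMA B:S. {t. set t \<subseteq> {..<n} \<and> length t = arity L B})"
    using finite_list by blast
  define m where "m = length ps"
  define atoms where "atoms = map (\<lambda>(B, t). Atom B t) ps"
  have len: "length atoms = m"
    by (simp add: atoms_def m_def)
  define c where "c i = interp M (fst (ps ! i)) (tuple (map a (snd (ps ! i))))" for i
  define c0 where "c0 = override_below n k (\<lambda>_. 0)"
  \<comment> \<open>Collects the lower bounds on the cube size \<open>q\<close>: those required by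
    the bump, and the prescribed bounds of the atoms in the context \<open>c0\<close> inside the
    block, which make the sentence restricted.\<close>
  define X where "X = insert 1 (insert \<epsilon> ((\<lambda>i. \<bar>c i\<bar> + \<epsilon>) ` {..<m} \<union> formula_bound L c0 ` set atoms))"
  obtain q :: nat where "Max X \<le> real q"
    using real_arch_simple by blast
  moreover have "finite X"
    by (simp add: X_def)
  ultimately have X_le: "x \<le> real q" if "x \<in> X" for x
    using that by (auto intro: order_trans[OF Max_ge])
  have q: "1 \<le> real q" "\<epsilon> \<le> real q" "\<And>i. i < m \<Longrightarrow> \<bar>c i\<bar> + \<epsilon> \<le> real q"
    "\<And>\<phi>. \<phi> \<in> set atoms \<Longrightarrow> formula_bound L c0 \<phi> \<le> real q"
    by (rule X_le; simp add: X_def)+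
  have "q \<ge> 1"
    using q(1) by simp
  obtain u where u: "continuous_map (product_topology (\<lambda>_. euclideanreal) {..<m}) euclideanreal u"
    "\<exists>g\<in>F q m. \<forall>v\<in>topspace (cube_topology q m). u v = g v" "\<forall>v. u v \<le> real q"
    "\<epsilon> / 2 < u (restrict c {..<m})" "\<forall>w. \<epsilon> / 2 < u w \<longrightarrow> (\<forall>i<m. \<bar>w i - c i\<bar> < \<epsilon>)"
    by (rule dense_connectives_bump[OF F \<open>q \<ge> 1\<close> q(2) \<epsilon> q(3)])
  define \<phi> where "\<phi> = sup_block k n (Conn u atoms)"
  have "wf_formula L \<phi>"
    using u(1) S(2) ps len by (auto simp: \<phi>_def wf_formula_sup_block atoms_def)
  moreover have "free_vars \<phi> = {}"
    using ps by (auto simp: \<phi>_def free_vars_sup_block atoms_def)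
  moreover have "restricted_in L F (\<lambda>_. 0) \<phi>"
    unfolding \<phi>_def restricted_in_sup_block c0_def[symmetric] restricted_in.simps len
  proof (intro conjI ballI)
    show "\<exists>n\<ge>1. (\<exists>g\<in>F n m. \<forall>v\<in>topspace (cube_topology n m). u v = g v) \<and>
        (\<forall>\<phi>\<in>set atoms. formula_bound L c0 \<phi> \<le> real n)"
      using \<open>q \<ge> 1\<close> u(2) q(4) by blast
    show "restricted_in L F c0 \<phi>" if "\<phi> \<in> set atoms" for \<phi>
      using that by (auto simp: atoms_def)
  qed
  moreover have "universal \<phi>"
    by (auto simp: \<phi>_def universal_sup_block atoms_def)
  ultimately have value_eq: "sentence_value M \<phi> = sentence_value N \<phi>"
    using eq by (simp add: restricted_sentence_def sentence_def)
  have ps_vars: "\<forall>(B, t)\<in>set ps. set t \<subseteq> {..<n}"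
    using ps by auto
  note kernel = eval_Conn_atoms[OF ps_vars, folded atoms_def m_def]
  have "\<epsilon> / 2 < u (restrict c {..<m})"
    by (rule u(4))
  also have "\<dots> = eval M (override_below n a (\<lambda>_. undefined)) (Conn u atoms)"
    unfolding kernel c_def ..
  \<comment> \<open>The connective is bounded by \<open>q\<close> on all arguments, so the kernel is
    bounded by \<open>q\<close> under every assignment, even outside the domains.\<close>
  also have "\<dots> \<le> sentence_value N \<phi>"
    unfolding value_eq[symmetric] unfolding sentence_value_def \<phi>_def
    by (rule eval_le_eval_sup_block[of _ _ "real q"]) (use u(3) a in auto)
  finally have "\<exists>b. (\<forall>i<n. b i \<in> domain N (k i)) \<and>
      \<epsilon> / 2 < eval N (override_below n b (\<lambda>_. undefined)) (Conn u atoms)"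
    unfolding sentence_value_def \<phi>_def by (rule eval_sup_block_witness) (use \<epsilon> in simp)
  then obtain b where b: "\<forall>i<n. b i \<in> domain N (k i)"
    "\<epsilon> / 2 < eval N (override_below n b (\<lambda>_. undefined)) (Conn u atoms)"
    by blast
  define w where "w = (\<lambda>i\<in>{..<m}. interp N (fst (ps ! i)) (tuple (map b (snd (ps ! i)))))"
  have "\<epsilon> / 2 < u w"
    using b(2) unfolding kernel w_def .
  then have close: "\<forall>i<m. \<bar>w i - c i\<bar> < \<epsilon>"
    using u(5) by blast
  show "\<exists>b. (\<forall>i<n. b i \<in> domain N (k i)) \<and>
      (\<forall>B\<in>S. \<forall>t. length t = arity L B \<and> set t \<subseteq> {..<n} \<longrightarrow>
        \<bar>interp N B (tuple (map b t)) - interp M B (tuple (map a t))\<bar> < \<epsilon>)"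
  proof (intro exI[of _ b] conjI b(1) ballI allI impI; elim conjE)
    fix B t assume "B \<in> S" "length t = arity L B" "set t \<subseteq> {..<n}"
    then have "(B, t) \<in> set ps"
      using ps by simp
    then obtain i where "i < m" "ps ! i = (B, t)"
      by (auto simp: in_set_conv_nth m_def)
    then show "\<bar>interp N B (tuple (map b t)) - interp M B (tuple (map a t))\<bar> < \<epsilon>"
      using close[rule_format, of i] by (simp add: w_def c_def)
  qed
qed

section \<open>Gromov--Hausdorff distance zero\<close>

lemma graph_lift_less_iff:
  "graph_lift n \<psi> (x, s) (y, t) < ennreal r \<longleftrightarrow>
     \<bar>s - t\<bar> < r \<and> (\<forall>i<n. \<psi> (x i) (y i) < ennreal r)"
  by (auto simp: graph_lift_def ennreal_less_iff)

lemma graph_lift_flip: "graph_lift n (\<lambda>y x. \<psi> x y) = (\<lambda>q p. graph_lift n \<psi> p q)"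
  by (simp add: graph_lift_def abs_minus_commute fun_eq_iff)

lemma approx_isometry_flip: "approx_isometry X Y \<psi> \<Longrightarrow> approx_isometry Y X (\<lambda>y x. \<psi> x y)"
  unfolding approx_isometry_def by blast

lemma eps_bijection_flip: "eps_bijection \<epsilon> X Y \<psi> \<Longrightarrow> eps_bijection \<epsilon> Y X (\<lambda>y x. \<psi> x y)"
  unfolding eps_bijection_def by blast

text \<open>Approximate isometries and \<epsilon>-bijections treat their two sides alike. The
  resulting symmetry of the distance later gives approximate copies in the opposite
  direction.\<close>

lemma domain_approx_isomorphism_flip:
  assumes "domain_approx_isomorphism L k S \<epsilon> M N \<psi>"
  shows "domain_approx_isomorphism L k S \<epsilon> N M (\<lambda>y x. \<psi> x y)"
  using assms
proof -
  have "approx_isometry UNIV UNIV \<psi>" "approx_isometry (domain M k) (domain N k) \<psi>"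
    and "\<forall>B\<in>S. eps_bijection \<epsilon> (rel_graph (arity L B) (domain M k) (interp M B))
      (rel_graph (arity L B) (domain N k) (interp N B)) (graph_lift (arity L B) \<psi>)"
    using assms unfolding domain_approx_isomorphism_def approx_isomorphism_def by blast+
  from this(1,2)[THEN approx_isometry_flip] this(3)[THEN bspec, THEN eps_bijection_flip]
  show ?thesis
    unfolding domain_approx_isomorphism_def approx_isomorphism_def graph_lift_flip[of _ \<psi>] by blast
qed

lemma level_distance_sym: "level_distance L Ls N M k = level_distance L Ls M N k"
proof -
  \<comment> \<open>Stated over fresh types so that it applies to the pair of structures in either
    order.\<close>
  have flip: "\<exists>\<psi>. \<forall>j\<le>k. domain_approx_isomorphism L j (Ls j) \<epsilon> N M \<psi>"
    if "\<exists>\<psi>. \<forall>j\<le>k. domain_approx_isomorphism L j (Ls j) \<epsilon> M N \<psi>"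
    for \<epsilon> and M :: "('a, 'x::polish_space) metric_structure" and N :: "('a, 'y::polish_space) metric_structure"
    using that domain_approx_isomorphism_flip by blast
  have "(\<exists>\<psi>. \<forall>j\<le>k. domain_approx_isomorphism L j (Ls j) \<epsilon> N M \<psi>) \<longleftrightarrow>
      (\<exists>\<psi>. \<forall>j\<le>k. domain_approx_isomorphism L j (Ls j) \<epsilon> M N \<psi>)" for \<epsilon>
    using flip[of \<epsilon> M N] flip[of \<epsilon> N M] by blast
  then show ?thesis
    by (simp add: level_distance_def)
qed

lemma gh_distance_sym: "gh_distance L Ls N M = gh_distance L Ls M N"
  by (simp add: gh_distance_def level_distance_sym[of L Ls N M])

lemma gh_distance_eq_0_iff: "gh_distance L Ls M N = 0 \<longleftrightarrow> (\<forall>k. level_distance L Ls M N k = 0)"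
  unfolding gh_distance_def by (subst suminf_eq_zero_iff) auto

lemma domain_approx_isomorphismE:
  assumes \<psi>: "domain_approx_isomorphism L k S \<epsilon> M N \<psi>" and "B \<in> S" "\<epsilon> < r"
    and x: "x \<in> {..<arity L B} \<rightarrow>\<^sub>E domain M k"
  obtains y where "y \<in> {..<arity L B} \<rightarrow>\<^sub>E domain N k"
    "\<forall>i<arity L B. \<psi> (x i) (y i) < ennreal r" "\<bar>interp M B x - interp N B y\<bar> < r"
proof -
  have "eps_bijection \<epsilon> (rel_graph (arity L B) (domain M k) (interp M B))
      (rel_graph (arity L B) (domain N k) (interp N B)) (graph_lift (arity L B) \<psi>)"
    using \<psi> \<open>B \<in> S\<close> by (simp add: domain_approx_isomorphism_def approx_isomorphism_def)
  moreover have "(x, interp M B x) \<in> rel_graph (arity L B) (domain M k) (interp M B)"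
    using x by (auto simp: rel_graph_def)
  ultimately obtain p where "p \<in> rel_graph (arity L B) (domain N k) (interp N B)"
    "graph_lift (arity L B) \<psi> (x, interp M B x) p < ennreal r"
    using \<open>\<epsilon> < r\<close> unfolding eps_bijection_def by blast
  then show thesis
    using that by (auto simp: rel_graph_def graph_lift_less_iff)
qed

lemma interp_modulus:
  assumes M: "is_structure L M" and "B \<in> symbols L" "\<epsilon> > 0"
    and "x \<in> {..<arity L B} \<rightarrow>\<^sub>E domain M k" "y \<in> {..<arity L B} \<rightarrow>\<^sub>E domain M k"
    and "\<And>i. i < arity L B \<Longrightarrow> dist (x i) (y i) < modulus L B k \<epsilon>"
  shows "\<bar>interp M B x - interp M B y\<bar> \<le> \<epsilon>"
proof -
  have "\<forall>x\<in>{..<arity L B} \<rightarrow>\<^sub>E domain M k. \<forall>y\<in>{..<arity L B} \<rightarrow>\<^sub>E domain M k. \<forall>\<epsilon>>0.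
      (\<forall>i<arity L B. dist (x i) (y i) < modulus L B k \<epsilon>) \<longrightarrow> \<bar>interp M B x - interp M B y\<bar> \<le> \<epsilon>"
    using M \<open>B \<in> symbols L\<close> unfolding is_structure_def by blast
  then show ?thesis
    using assms by blast
qed

text \<open>A level \<open>K\<close> above all symbols and domain indices involved gives one
  \<open>\<psi>\<close> for all levels up to \<open>K\<close>. Level \<open>k i\<close> provides a
  point \<open>b i\<close> in the right domain; level \<open>K\<close> provides, for each relation
  and tuple, another copy with almost the same value. Both copies are close to the original, hence
  to each other, and the modulus of \<open>N\<close> on domain \<open>K\<close> compares
  them.\<close>

lemma gh_distance_0_imp_approx_embeds:
  fixes M :: "('r, 'm::polish_space) metric_structure" and N :: "('r, 'n::polish_space) metric_structure"
  assumes lang: "is_language L" and Ls: "exhaustion L Ls" and N: "is_structure L N"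
    and M: "is_structure L M" and gh: "gh_distance L Ls M N = 0"
  shows "approx_embeds L M N"
  unfolding approx_embeds_def
proof (intro allI impI; elim conjE)
  fix n :: nat and a k and S :: "'r set" and \<epsilon> :: real
  assume \<epsilon>: "\<epsilon> > 0" and S: "finite S" "S \<subseteq> symbols L" and a: "\<forall>i<n. a i \<in> domain M (k i)"
  have mono: "Ls i \<subseteq> Ls j" "domain M i \<subseteq> domain M j" "domain N i \<subseteq> domain N j" if "i \<le> j" for i j
    using Ls M N that by (auto simp: exhaustion_def is_structure_def incseq_def)
  have "\<forall>B\<in>S. \<exists>j. B \<in> Ls j"
    using S(2) Ls by (auto simp: exhaustion_def)
  then obtain lev where lev: "\<forall>B\<in>S. B \<in> Ls (lev B)"
    unfolding bchoice_iff by blast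
  define K where "K = Max (insert 0 (lev ` S \<union> k ` {..<n}))"
  have "finite (insert 0 (lev ` S \<union> k ` {..<n}))"
    using S(1) by simp
  then have K: "\<And>B. B \<in> S \<Longrightarrow> lev B \<le> K" "\<And>i. i < n \<Longrightarrow> k i \<le> K"
    unfolding K_def by (rule Max_ge; simp)+
  have SK: "B \<in> Ls K" if "B \<in> S" for B
    using lev K(1)[OF that] mono(1) that by blast
  \<comment> \<open>Two steps of size below \<open>\<mu> / 4\<close> stay within
    \<open>\<mu> / 2\<close>, which is below the moduli for \<open>\<epsilon> / 2\<close>. The total
    error in a relation is below \<open>\<mu> / 4 + \<epsilon> / 2\<close>, hence below
    \<epsilon>.\<close>
  define \<mu> where "\<mu> = Min (insert \<epsilon> ((\<lambda>B. modulus L B K (\<epsilon> / 2)) ` S))"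
  have \<mu>: "0 < \<mu>" "\<mu> \<le> \<epsilon>" "\<And>B. B \<in> S \<Longrightarrow> \<mu> \<le> modulus L B K (\<epsilon> / 2)"
    using S \<epsilon> lang by (auto simp: \<mu>_def is_language_def)
  have "level_distance L Ls M N K < ennreal (\<mu> / 4)"
    using gh \<mu>(1) by (simp add: gh_distance_eq_0_iff)
  then obtain \<epsilon>' \<psi> where \<psi>: "\<epsilon>' > 0" "\<epsilon>' < \<mu> / 4"
    "\<forall>j\<le>K. domain_approx_isomorphism L j (Ls j) \<epsilon>' M N \<psi>"
    unfolding level_distance_def Inf_less_iff by (auto simp: ennreal_less_iff)
  \<comment> \<open>Closeness of single points is read off the graph of the metric, present at every
    level, at the pair \<open>(a i, a i)\<close>. Level \<open>k i\<close> rather than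
    \<open>K\<close> is used to keep the copy in \<open>domain N (k i)\<close>.\<close>
  have "\<exists>y\<in>domain N (k i). \<psi> (a i) y < ennreal (\<mu> / 4)" if i: "i < n" for i
  proof -
    have d: "metric_symbol L \<in> Ls (k i)" "arity L (metric_symbol L) = 2"
      using Ls lang mono(1)[of 0 "k i"] by (auto simp: exhaustion_def is_language_def)
    have x: "tuple [a i, a i] \<in> {..<arity L (metric_symbol L)} \<rightarrow>\<^sub>E domain M (k i)"
      using tuple_in_PiE[of "[a i, a i]" "domain M (k i)"] a i d(2) by (simp add: numeral_2_eq_2)
    obtain y where y: "y \<in> {..<arity L (metric_symbol L)} \<rightarrow>\<^sub>E domain N (k i)"
      "\<forall>l<arity L (metric_symbol L). \<psi> (tuple [a i, a i] l) (y l) < ennreal (\<mu> / 4)"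
      by (rule domain_approx_isomorphismE[OF \<psi>(3)[rule_format, OF K(2)[OF i]] d(1) \<psi>(2) x])
    have "0 < arity L (metric_symbol L)"
      using d(2) by simp
    then have "y 0 \<in> domain N (k i)" "\<psi> (tuple [a i, a i] 0) (y 0) < ennreal (\<mu> / 4)"
      using y(2) PiE_mem[OF y(1)] by blast+
    then have "y 0 \<in> domain N (k i)" "\<psi> (a i) (y 0) < ennreal (\<mu> / 4)"
      by (simp_all add: tuple_apply)
    then show ?thesis
      by blast
  qed
  then have "\<forall>i. \<exists>y. i < n \<longrightarrow> y \<in> domain N (k i) \<and> \<psi> (a i) y < ennreal (\<mu> / 4)"
    by blast
  then obtain b where b: "\<And>i. i < n \<Longrightarrow> b i \<in> domain N (k i)"
    "\<And>i. i < n \<Longrightarrow> \<psi> (a i) (b i) < ennreal (\<mu> / 4)"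
    unfolding choice_iff by blast
  \<comment> \<open>The Katetov inequality bounding a distance by a sum: two points of
    \<open>N\<close> that are close to the same point of \<open>M\<close> are close to each
    other.\<close>
  have katetov: "dist y z \<le> \<mu> / 2" if "\<psi> x y < ennreal (\<mu> / 4)" "\<psi> x z < ennreal (\<mu> / 4)" for x y z
  proof -
    have "katetov_on UNIV (\<psi> x)"
      using \<psi>(3)[rule_format, of 0] by (simp add: domain_approx_isomorphism_def approx_isometry_def)
    then have "ennreal (dist y z) \<le> \<psi> x y + \<psi> x z"
      by (simp add: katetov_on_def)
    also have "\<dots> \<le> ennreal (\<mu> / 4) + ennreal (\<mu> / 4)"
      using that by (intro add_mono less_imp_le)
    also have "\<dots> = ennreal (\<mu> / 2)"
      using \<mu>(1) by (simp flip: ennreal_plus)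
    finally show ?thesis
      using \<mu>(1) by (simp add: ennreal_le_iff)
  qed
  show "\<exists>b. (\<forall>i<n. b i \<in> domain N (k i)) \<and>
      (\<forall>B\<in>S. \<forall>t. length t = arity L B \<and> set t \<subseteq> {..<n} \<longrightarrow>
        \<bar>interp N B (tuple (map b t)) - interp M B (tuple (map a t))\<bar> < \<epsilon>)"
  proof (intro exI[of _ b] conjI ballI allI impI b(1); (elim conjE)?)
    fix B t assume B: "B \<in> S" and t: "length t = arity L B" "set t \<subseteq> {..<n}"
    have tn: "t ! i < n" if "i < arity L B" for i
      using that t(1) subsetD[OF t(2) nth_mem[of i t]] by simp
    have tK: "tuple (map c t) \<in> {..<arity L B} \<rightarrow>\<^sub>E A"
      if "\<And>i. i < n \<Longrightarrow> c i \<in> A" for c A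
      using tuple_in_PiE[of "map c t" A] that t by auto
    have aK: "tuple (map a t) \<in> {..<arity L B} \<rightarrow>\<^sub>E domain M K"
      using a K(2) mono(2) by (intro tK) blast
    have bK: "tuple (map b t) \<in> {..<arity L B} \<rightarrow>\<^sub>E domain N K"
      using b(1) K(2) mono(3) by (intro tK) blast
    \<comment> \<open>This copy depends on \<open>B\<close> and \<open>t\<close>, whereas
      \<open>b\<close> was fixed beforehand; it only mediates between the values at \<open>a\<close>
      and at \<open>b\<close>.\<close>
    obtain y where y: "y \<in> {..<arity L B} \<rightarrow>\<^sub>E domain N K"
      "\<forall>i<arity L B. \<psi> (tuple (map a t) i) (y i) < ennreal (\<mu> / 4)"
      "\<bar>interp M B (tuple (map a t)) - interp N B y\<bar> < \<mu> / 4"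
      by (rule domain_approx_isomorphismE[OF \<psi>(3)[rule_format, OF order_refl] SK[OF B] \<psi>(2) aK])
    have "dist (y i) (tuple (map b t) i) < modulus L B K (\<epsilon> / 2)" if "i < arity L B" for i
    proof -
      have "dist (y i) (b (t ! i)) \<le> \<mu> / 2"
        using y(2) b(2)[OF tn[OF that]] that t(1) by (intro katetov[of "a (t ! i)"]) (auto simp: tuple_apply)
      then show ?thesis
        using \<mu>(1) \<mu>(3)[OF B] that t(1) by (simp add: tuple_apply)
    qed
    then have "\<bar>interp N B y - interp N B (tuple (map b t))\<bar> \<le> \<epsilon> / 2"
      using S(2) B \<epsilon> by (intro interp_modulus[OF N _ _ y(1) bK]) auto
    then show "\<bar>interp N B (tuple (map b t)) - interp M B (tuple (map a t))\<bar> < \<epsilon>"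
      using y(3) \<mu>(1,2) by linarith
  qed
qed

text \<open>With \<open>\<psi> x y\<close> the distance from \<open>f x\<close> to \<open>y\<close>,
  the Katetov conditions are triangle inequalities. A tuple and its image are at
  \<open>\<psi>\<close>-distance 0 with equal relation values, so this one \<open>\<psi>\<close>
  works for every level and every positive \<epsilon>.\<close>

lemma isomorphic_imp_gh_distance_0:
  assumes "isomorphic L M N" and Ls: "exhaustion L Ls"
  shows "gh_distance L Ls M N = 0"
proof -
  obtain f where f: "bij f" "embedding L M N f" "embedding L N M (inv f)"
    "\<forall>k. f ` domain M k = domain N k"
    using assms(1) by (rule isomorphicE)
  define \<psi> where "\<psi> x y = ennreal (dist (f x) y)" for x y
  have iso: "dist x y = dist (f x) (f y)" for x y
    using f(2) by (simp add: embedding_def)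
  have approx: "approx_isometry X Y \<psi>" for X Y
    unfolding approx_isometry_def katetov_on_def \<psi>_def
  proof (intro conjI ballI)
    fix x y z
    show "ennreal (dist (f x) y) \<le> ennreal (dist (f x) z) + ennreal (dist y z)"
      "ennreal (dist (f x) z) \<le> ennreal (dist (f x) y) + ennreal (dist y z)"
      "ennreal (dist y z) \<le> ennreal (dist (f x) y) + ennreal (dist (f x) z)"
      unfolding ennreal_plus[OF zero_le_dist zero_le_dist, symmetric]
      by (intro ennreal_leI, metric)+
  next
    fix y x z
    show "ennreal (dist (f x) y) \<le> ennreal (dist (f z) y) + ennreal (dist x z)"
      "ennreal (dist (f z) y) \<le> ennreal (dist (f x) y) + ennreal (dist x z)"
      "ennreal (dist x z) \<le> ennreal (dist (f x) y) + ennreal (dist (f z) y)"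
      unfolding ennreal_plus[OF zero_le_dist zero_le_dist, symmetric] iso[of x z]
      by (intro ennreal_leI, metric)+
  qed
  have "domain_approx_isomorphism L j (Ls j) \<epsilon> M N \<psi>" if \<epsilon>: "\<epsilon> > 0" for j \<epsilon>
    unfolding domain_approx_isomorphism_def approx_isomorphism_def eps_bijection_def rel_graph_def
  proof (intro conjI approx ballI allI impI; elim imageE)
    fix B r and p :: "(nat \<Rightarrow> 'b) \<times> real" and x assume "B \<in> Ls j" "\<epsilon> < r"
      and p: "p = (x, interp M B x)" and x: "x \<in> {..<arity L B} \<rightarrow>\<^sub>E domain M j"
    then have B: "B \<in> symbols L"
      using Ls by (auto simp: exhaustion_def)
    let ?y = "compose {..<arity L B} f x"
    have "?y \<in> {..<arity L B} \<rightarrow>\<^sub>E domain N j"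
      using x f(4) by (auto simp: compose_def)
    then have "(?y, interp N B ?y) \<in> (\<lambda>x. (x, interp N B x)) ` ({..<arity L B} \<rightarrow>\<^sub>E domain N j)"
      by (rule imageI)
    moreover have "interp N B ?y = interp M B x"
      using f(2) B PiE_mono_domain[OF x] by (simp add: embedding_def)
    ultimately show "\<exists>q\<in>(\<lambda>x. (x, interp N B x)) ` ({..<arity L B} \<rightarrow>\<^sub>E domain N j).
        graph_lift (arity L B) \<psi> p q < ennreal r"
      using \<epsilon> \<open>\<epsilon> < r\<close>
      by (intro bexI[of _ "(?y, interp N B ?y)"], unfold p graph_lift_less_iff)
        (simp_all add: \<psi>_def compose_def)
  next
    fix B r and p :: "(nat \<Rightarrow> 'c) \<times> real" and y assume "B \<in> Ls j" "\<epsilon> < r"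
      and p: "p = (y, interp N B y)" and y: "y \<in> {..<arity L B} \<rightarrow>\<^sub>E domain N j"
    then have B: "B \<in> symbols L"
      using Ls by (auto simp: exhaustion_def)
    let ?x = "compose {..<arity L B} (inv f) y"
    have "inv f ` domain N j \<subseteq> domain M j"
      using f(3) by (simp add: embedding_def)
    then have "?x \<in> {..<arity L B} \<rightarrow>\<^sub>E domain M j"
      using y by (auto simp: compose_def)
    then have "(?x, interp M B ?x) \<in> (\<lambda>x. (x, interp M B x)) ` ({..<arity L B} \<rightarrow>\<^sub>E domain M j)"
      by (rule imageI)
    moreover have "interp M B ?x = interp N B y"
      using f(3) B PiE_mono_domain[OF y] by (simp add: embedding_def)
    ultimately show "\<exists>q\<in>(\<lambda>x. (x, interp M B x)) ` ({..<arity L B} \<rightarrow>\<^sub>E domain M j).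
        graph_lift (arity L B) \<psi> q p < ennreal r"
      using \<epsilon> \<open>\<epsilon> < r\<close> surj_f_inv_f[OF bij_is_surj[OF f(1)]]
      by (intro bexI[of _ "(?x, interp M B ?x)"], unfold p graph_lift_less_iff)
        (simp_all add: \<psi>_def compose_def)
  qed
  then have "level_distance L Ls M N k \<le> ennreal \<epsilon>" if "\<epsilon> > 0" for k \<epsilon>
    unfolding level_distance_def using that
    by (intro Inf_lower CollectI exI[of _ \<epsilon>] conjI refl exI[of _ \<psi>]) simp_all
  then have "level_distance L Ls M N k \<le> 0" for k
    by - (rule ennreal_le_epsilon, simp)
  then show ?thesis
    by (simp add: gh_distance_eq_0_iff)
qed

section \<open>The equivalences\<close>

theorem proposition5p3:
  fixes L :: "'r language"
    and Ls :: "nat \<Rightarrow> 'r set"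
    and F :: "nat \<Rightarrow> nat \<Rightarrow> ((nat \<Rightarrow> real) \<Rightarrow> real) set"
    and M :: "('r, 'm::polish_space) metric_structure"
    and N :: "('r, 'n::polish_space) metric_structure"
  assumes "is_language L" and "countable (symbols L)"
    and "exhaustion L Ls"
    and "dense_connectives F"
    and "is_structure L M" and "proper M"
    and "is_structure L N" and "proper N"
  shows
    "((\<forall>\<phi>. restricted_sentence L F \<phi> \<and> universal \<phi> \<longrightarrow> sentence_value M \<phi> = sentence_value N \<phi>) \<longleftrightarrow>
      (\<forall>\<phi>. sentence L \<phi> \<and> universal \<phi> \<longrightarrow> sentence_value M \<phi> = sentence_value N \<phi>)) \<and>
     ((\<forall>\<phi>. sentence L \<phi> \<and> universal \<phi> \<longrightarrow> sentence_value M \<phi> = sentence_value N \<phi>) \<longleftrightarrow>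
      (\<forall>\<phi>. sentence L \<phi> \<and> existential \<phi> \<longrightarrow> sentence_value M \<phi> = sentence_value N \<phi>)) \<and>
     ((\<forall>\<phi>. sentence L \<phi> \<and> existential \<phi> \<longrightarrow> sentence_value M \<phi> = sentence_value N \<phi>) \<longleftrightarrow>
      gh_distance L Ls M N = 0) \<and>
     (gh_distance L Ls M N = 0 \<longleftrightarrow> isomorphic L M N) \<and>
     (isomorphic L M N \<longleftrightarrow> embeds L M N \<and> embeds L N M)"
    (is "(?restricted \<longleftrightarrow> ?universal) \<and> (_ \<longleftrightarrow> ?existential) \<and> (_ \<longleftrightarrow> ?gh) \<and> (_ \<longleftrightarrow> ?iso) \<and> (_ \<longleftrightarrow> ?bi)")
proof -
  have bi: ?bi if "approx_embeds L M N" "approx_embeds L N M"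
    using that assms by (blast intro: approx_embeds_imp_embeds)
  \<comment> \<open>Isomorphism gives the other conditions, the restricted one by way of
    \<open>?universal\<close>. Conversely \<open>?existential\<close> leads through
    \<open>?universal\<close> to \<open>?restricted\<close>, and \<open>?restricted\<close> and
    \<open>?gh\<close> each lead to \<open>?bi\<close>, hence back to \<open>?iso\<close>.\<close>
  have "?iso \<Longrightarrow> ?universal" "?iso \<Longrightarrow> ?existential" "?iso \<Longrightarrow> ?gh" "?iso \<Longrightarrow> ?bi"
    using isomorphic_imp_sentence_value_eq isomorphic_imp_gh_distance_0[OF _ assms(3)]
      isomorphic_imp_embeds by blast+
  moreover have "?bi \<Longrightarrow> ?iso"
    using assms(7,8) bi_embeddable_imp_isomorphic by blast
  moreover have "?universal \<Longrightarrow> ?restricted"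
    by (simp add: restricted_sentence_def)
  moreover have "?existential \<Longrightarrow> ?universal"
    using existential_eq_imp_universal_eq by blast
  moreover have ?bi if ?restricted
  proof (rule bi)
    show "approx_embeds L M N" "approx_embeds L N M"
      using assms(4) that by (auto intro!: restricted_universal_imp_approx_embeds)
  qed
  moreover have ?bi if ?gh
  proof (rule bi)
    show "approx_embeds L M N"
      using assms(1,3,7,5) that by (rule gh_distance_0_imp_approx_embeds)
    have "gh_distance L Ls N M = 0"
      using that gh_distance_sym[of L Ls N M] by simp
    with assms(1,3,5,7) show "approx_embeds L N M"
      by (rule gh_distance_0_imp_approx_embeds)
  qed
  ultimately show ?thesis
    by argo
qed

end
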